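(* Fix constants $Q>0$, $n>0$, $\mu_i>0$, $\mu_o>0$, $0<R_1(0)<R_2(0)$ and a time $\tau\ge 0$. Put $R_0^2(\tau)=Q\tau/\pi$, $R_1^2(\tau)=Q\tau/\pi+R_1^2(0)$, $R_2^2(\tau)=Q\tau/\pi+R_2^2(0)$ and $\zeta_1=R_1^2(0)/R_2^2(0)$. Let $T_1,T_2$ be real constants and set $$F_1=\frac{Qn}{2\pi R_1^2(\tau)}\big(\mu(\zeta_1)-\mu_i\big)-T_1\frac{n^3-n}{R_1^3(\tau)},\qquad F_2=\frac{Qn}{2\pi R_2^2(\tau)}\big(\mu_o-\mu(1)\big)-T_2\frac{n^3-n}{R_2^3(\tau)},$$ and assume $F_1>0$ and $F_2>0$. Let $\mu$ be a positive, strictly increasing function in $C^1([\zeta_1,1])$. Consider the eigenvalue problem, for $f$ on $[\zeta_1,1]$ and $\lambda\in\mathbb{C}$: $$\Big(\big(\zeta R_2^2(0)+R_0^2(\tau)\big)\mu(\zeta) f'(\zeta)\Big)'-\Big(\frac{n^2R_2^4(0)}{4(\zeta R_2^2(0)+R_0^2(\tau))}\mu(\zeta)-\frac{Qn^2R_2^2(0)}{4\pi(\zeta R_2^2(0)+R_0^2(\tau))}\mu'(\zeta)\lambda\Big)f(\zeta)=0,\quad \zeta_1<\zeta<1,$$ $$(\mu_i-\lambda F_1)f(\zeta_1)-\frac{2R_1^2(\tau)}{nR_2^2(0)}\mu(\zeta_1)f'(\zeta_1)=0,\qquad (\mu_o-\lambda F_2)f(1)+\frac{2R_2^2(\tau)}{nR_2^2(0)}\mu(1)f'(1)=0.$$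 Then this problem has a countably infinite number of real eigenvalues, which can be ordered as $0<\lambda_0<\lambda_1<\lambda_2<\cdots$, such that the corresponding eigenfunction $f_i$ has exactly $i$ zeros in the open interval $(\zeta_1,1)$. Moreover, the eigenfunctions are continuous with continuous derivative.
   Context: This eigenvalue problem arises from the linear stability analysis of three-layer radial Hele-Shaw flow in a transformed coordinate $\zeta$; $\lambda=1/\sigma$ where $\sigma$ is the growth rate of a disturbance with angular wave number $n$, $\mu_i,\mu_o$ are the inner/outer fluid viscosities, $\mu(\zeta)$ is the middle-layer viscous profile, $T_1,T_2$ are interfacial tensions and $Q$ is the injection rate. *)

theory Defs
  imports "HOL-Analysis.Analysis"
begin

definition R0sq :: "real \<Rightarrow> real \<Rightarrow> real" where
  "R0sq Q tau = Q * tau / pi"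
definition R1sq :: "real \<Rightarrow> real \<Rightarrow> real \<Rightarrow> real" where
  "R1sq Q R10 tau = Q * tau / pi + R10\<^sup>2"
definition R2sq :: "real \<Rightarrow> real \<Rightarrow> real \<Rightarrow> real" where
  "R2sq Q R20 tau = Q * tau / pi + R20\<^sup>2"
definition zeta1 :: "real \<Rightarrow> real \<Rightarrow> real" where
  "zeta1 R10 R20 = R10\<^sup>2 / R20\<^sup>2"

definition F1 :: "real \<Rightarrow> real \<Rightarrow> real \<Rightarrow> real \<Rightarrow> real \<Rightarrow> real \<Rightarrow> real \<Rightarrow> (real \<Rightarrow> real) \<Rightarrow> real" where
  "F1 Q n mui R10 R20 tau T1 mu =
     Q * n / (2 * pi * R1sq Q R10 tau) * (mu (zeta1 R10 R20) - mui)
     - T1 * (n ^ 3 - n) / (sqrt (R1sq Q R10 tau)) ^ 3"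

definition F2 :: "real \<Rightarrow> real \<Rightarrow> real \<Rightarrow> real \<Rightarrow> real \<Rightarrow> real \<Rightarrow> (real \<Rightarrow> real) \<Rightarrow> real" where
  "F2 Q n muo R20 tau T2 mu =
     Q * n / (2 * pi * R2sq Q R20 tau) * (muo - mu 1)
     - T2 * (n ^ 3 - n) / (sqrt (R2sq Q R20 tau)) ^ 3"

definition eigenpair ::
  "real \<Rightarrow> real \<Rightarrow> real \<Rightarrow> real \<Rightarrow> real \<Rightarrow> real \<Rightarrow> real \<Rightarrow> real \<Rightarrow> real
   \<Rightarrow> (real \<Rightarrow> real) \<Rightarrow> (real \<Rightarrow> real) \<Rightarrow> complex \<Rightarrow> (real \<Rightarrow> complex) \<Rightarrow> bool" where
  "eigenpair Q n mui muo R10 R20 tau T1 T2 mu mu' lam f \<longleftrightarrow>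
    (let z1 = zeta1 R10 R20;
         p = (\<lambda>z. z * R20\<^sup>2 + R0sq Q tau)
     in (\<exists>x\<in>{z1..1}. f x \<noteq> 0) \<and>
        (\<exists>f' g.
          (\<forall>x\<in>{z1..1}. (f has_vector_derivative f' x) (at x within {z1..1})) \<and>
          (\<forall>x\<in>{z1<..<1}.
             ((\<lambda>z. complex_of_real (p z * mu z) * f' z) has_vector_derivative g x) (at x) \<and>
             g x - (complex_of_real (n\<^sup>2 * R20 ^ 4 / (4 * p x) * mu x)
                    - complex_of_real (Q * n\<^sup>2 * R20\<^sup>2 / (4 * pi * p x) * mu' x) * lam) * f x = 0) \<and>
          (complex_of_real mui - lam * complex_of_real (F1 Q n mui R10 R20 tau T1 mu)) * f z1
            - complex_of_real (2 * R1sq Q R10 tau / (n * R20\<^sup>2) * mu z1) * f' z1 = 0 \<and>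
          (complex_of_real muo - lam * complex_of_real (F2 Q n muo R20 tau T2 mu)) * f 1
            + complex_of_real (2 * R2sq Q R20 tau / (n * R20\<^sup>2) * mu 1) * f' 1 = 0))"

end

theory Submission
  imports Defs
begin

text \<open>
  Writing \<open>V = P f'\<close> with \<open>P = p \<mu>\<close>, the problem becomes the first-order system \<open>f' = V / P\<close>,
  \<open>V' = (q - \<lambda> w) f\<close> with \<open>P, q > 0\<close> and \<open>w \<ge> 0\<close>, where \<open>w\<close> vanishes on no interval because \<open>\<mu>\<close> is
  strictly increasing. The monotone quantity \<open>Im (V f\<^sup>*)\<close> forces eigenvalues to be real. For real
  \<open>\<lambda>\<close> the Pruefer substitution \<open>f = r sin \<theta>\<close>, \<open>V = r cos \<theta>\<close> decouples the angle:
  \<open>\<theta>' = cos\<^sup>2 \<theta> / P + (\<lambda> w - q) sin\<^sup>2 \<theta>\<close>. The left boundary condition prescribes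
  \<open>\<theta>(\<zeta>\<^sub>1) \<in> (0, \<pi>)\<close>, strictly increasing in \<open>\<lambda>\<close>, and the right one asks for
  \<open>\<theta>(1) = \<phi>(\<lambda>) + k \<pi>\<close> with \<open>\<phi>(\<lambda>) \<in> (0, \<pi>)\<close> strictly decreasing. By comparison
  \<open>\<theta>(1) - \<phi>(\<lambda>)\<close> is continuous and strictly increasing in \<open>\<lambda>\<close>; it exceeds \<open>-\<pi>\<close> everywhere, is negative
  at \<open>\<lambda> = 0\<close>, and tends to infinity by oscillation, so each \<open>k \<ge> 0\<close> is hit at exactly one \<open>\<lambda>\<^sub>k > 0\<close>.
  Since \<open>\<theta>\<close> crosses multiples of \<open>\<pi>\<close> only upwards, \<open>f\<^sub>k\<close> has exactly \<open>k\<close> interior zeros.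
\<close>

section \<open>A global Picard theorem and a barrier lemma\<close>

text \<open>The Lipschitz constant is uniform in \<open>y\<close>, which rules out blow-up: one
  contraction on a space of bounded continuous functions covers the whole interval, without
  continuation of local solutions.\<close>

lemma picard_global:
  fixes G :: "real \<Rightarrow> real \<Rightarrow> real"
  assumes ab: "a \<le> b" and K: "K > 0"
    and cont: "continuous_on ({a..b} \<times> UNIV) (\<lambda>(t, y). G t y)"
    and lip: "\<And>t y z. t \<in> {a..b} \<Longrightarrow> \<bar>G t y - G t z\<bar> \<le> K * \<bar>y - z\<bar>"
  obtains \<theta> where "\<theta> a = y0"
    "\<And>x. x \<in> {a..b} \<Longrightarrow> (\<theta> has_real_derivative G x (\<theta> x)) (at x within {a..b})"
proof -
  \<comment> \<open>The contraction factor comes out as \<open>K / L\<close>, so this weight yields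
    1/2.\<close>
  define L where "L = 2 * K"
  have L: "L > 0" using K by (simp add: L_def)
  have cancel: "exp (- L * (x - a)) * exp (L * (x - a)) = 1" for x
    by (simp add: mult_exp_exp)
  \<comment> \<open>Conjugating with the exponential weight makes the Picard operator a contraction on all of the interval.\<close>
  define I where "I \<psi> t = G t (exp (L * (t - a)) * apply_bcontfun \<psi> t)" for \<psi> :: "real \<Rightarrow>\<^sub>C real" and t
  define H where "H \<psi> x = exp (- L * (x - a)) * (y0 + integral {a..x} (I \<psi>))" for \<psi> x
  have contI: "continuous_on {a..b} (I \<psi>)" for \<psi>
  proof -
    have "continuous_on {a..b} ((\<lambda>(t, y). G t y) \<circ> (\<lambda>t. (t, exp (L * (t - a)) * apply_bcontfun \<psi> t)))"
      by (rule continuous_on_compose) (auto intro!: continuous_intros continuous_on_subset[OF cont])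
    then show ?thesis by (simp add: I_def o_def)
  qed
  have intI: "I \<psi> integrable_on {a..x}" if "x \<in> {a..b}" for \<psi> x
    using that by (intro integrable_continuous_real continuous_on_subset[OF contI]) auto
  have contH: "continuous_on {a..b} (H \<psi>)" for \<psi>
    unfolding H_def using indefinite_integral_continuous_1[OF intI, of b \<psi>] ab
    by (intro continuous_intros) auto
  \<comment> \<open>Clamping the argument extends \<open>H \<psi>\<close> to a bounded continuous
    function on the whole line, so the operator acts on a complete space.\<close>
  have "\<exists>\<eta> :: real \<Rightarrow>\<^sub>C real. \<forall>x. \<eta> x = H \<psi> (clamp a b x)" for \<psi>
    using continuous_on_cbox_bcontfunE[of a b "H \<psi>"] contH[of \<psi>] by (metis box_real(2))
  then obtain T :: "(real \<Rightarrow>\<^sub>C real) \<Rightarrow> (real \<Rightarrow>\<^sub>C real)" where T: "T \<psi> x = H \<psi> (clamp a b x)" for \<psi> x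
    by metis
  have clamp: "clamp a b x \<in> {a..b}" for x
    using clamp_in_interval[of a b x] ab by simp
  have bound: "\<bar>H \<psi> x - H \<phi> x\<bar> \<le> 1 / 2 * dist \<psi> \<phi>" if x: "x \<in> {a..b}" for \<psi> \<phi> x
  proof -
    define D where "D = dist \<psi> \<phi>"
    have "\<bar>I \<psi> t - I \<phi> t\<bar> \<le> K * D * exp (L * (t - a))" if "t \<in> {a..x}" for t
    proof -
      have "\<bar>I \<psi> t - I \<phi> t\<bar> \<le> K * \<bar>exp (L * (t - a)) * \<psi> t - exp (L * (t - a)) * \<phi> t\<bar>"
        unfolding I_def using that x by (intro lip) auto
      also have "\<dots> = K * exp (L * (t - a)) * dist (\<psi> t) (\<phi> t)"
        by (simp add: dist_real_def abs_mult right_diff_distrib[symmetric])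
      also have "\<dots> \<le> K * exp (L * (t - a)) * D"
        unfolding D_def using K by (intro mult_left_mono dist_bounded) auto
      finally show ?thesis by (simp add: mult_ac)
    qed
    moreover have FTC: "((\<lambda>t. K * D * exp (L * (t - a))) has_integral
        (K * D * exp (L * (x - a)) / L - K * D * exp (L * (a - a)) / L)) {a..x}"
      using x L by (intro fundamental_theorem_of_calculus)
        (auto intro!: derivative_eq_intros simp: has_real_derivative_iff_has_vector_derivative[symmetric])
    ultimately have "norm (integral {a..x} (\<lambda>t. I \<psi> t - I \<phi> t))
        \<le> integral {a..x} (\<lambda>t. K * D * exp (L * (t - a)))"
      by (intro integral_norm_bound_integral integrable_diff intI x) auto
    also have "\<dots> \<le> K * D * exp (L * (x - a)) / L"
      using integral_unique[OF FTC] K L by (simp add: D_def)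
    finally have int: "\<bar>integral {a..x} (I \<psi>) - integral {a..x} (I \<phi>)\<bar> \<le> D / 2 * exp (L * (x - a))"
      using K by (simp add: integral_diff[OF intI[OF x] intI[OF x]] L_def)
    have "\<bar>H \<psi> x - H \<phi> x\<bar> = exp (- L * (x - a)) * \<bar>integral {a..x} (I \<psi>) - integral {a..x} (I \<phi>)\<bar>"
      by (simp add: H_def right_diff_distrib[symmetric] abs_mult)
    also have "\<dots> \<le> exp (- L * (x - a)) * (D / 2 * exp (L * (x - a)))"
      by (intro mult_left_mono int) auto
    also have "\<dots> = D / 2"
      using cancel[of x] by (simp add: mult.left_commute)
    finally show ?thesis by (simp add: D_def)
  qed
  have "\<exists>!\<psi>. T \<psi> = \<psi>"
  proof (rule banach_fix_type[of "1/2"])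
    show "\<forall>\<psi> \<phi>. dist (T \<psi>) (T \<phi>) \<le> 1 / 2 * dist \<psi> \<phi>"
      by (intro allI dist_bound) (use bound[OF clamp] in \<open>auto simp: T dist_real_def\<close>)
  qed auto
  then obtain \<psi> where \<psi>: "T \<psi> = \<psi>" by blast
  define \<theta> where "\<theta> x = y0 + integral {a..x} (I \<psi>)" for x
  have \<psi>eq: "exp (L * (x - a)) * \<psi> x = \<theta> x" if "x \<in> {a..b}" for x
  proof -
    have "\<psi> x = H \<psi> x" using T[of \<psi> x] \<psi> that by simp
    then show ?thesis
      using cancel[of x] by (simp add: H_def \<theta>_def mult.assoc[symmetric] mult.commute)
  qed
  show ?thesis
  proof
    show "\<theta> a = y0" by (simp add: \<theta>_def)
    show "(\<theta> has_real_derivative G x (\<theta> x)) (at x within {a..b})" if x: "x \<in> {a..b}" for x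
    proof -
      have "(\<theta> has_real_derivative 0 + I \<psi> x) (at x within {a..b})"
        unfolding \<theta>_def by (intro DERIV_add DERIV_const integral_has_real_derivative contI x)
      then show ?thesis using \<psi>eq[OF x] by (simp add: I_def)
    qed
  qed
qed

text \<open>Zero can only be crossed upwards, since the slope is positive wherever \<open>g\<close>
  vanishes. This barrier principle drives the comparison, Gronwall and uniqueness arguments that
  follow.\<close>

lemma pos_if_deriv_pos_at_zeros:
  fixes g g' :: "real \<Rightarrow> real"
  assumes der: "\<And>x. x \<in> {c..e} \<Longrightarrow> (g has_real_derivative g' x) (at x within {c..e})"
    and gc: "0 \<le> g c"
    and pos: "\<And>x. x \<in> {c..e} \<Longrightarrow> g x = 0 \<Longrightarrow> 0 < g' x"
    and x: "c < x" "x \<le> e"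
  shows "0 < g x"
proof -
  have cont: "continuous_on {c..e} g"
    using der by (rule DERIV_continuous_on)
  have nonneg: "0 \<le> g y" if y: "y \<in> {c..e}" for y
  proof (rule ccontr)
    assume "\<not> 0 \<le> g y"
    then have gy: "g y < 0" by simp
    \<comment> \<open>\<open>Sup S\<close> is the last point up to \<open>y\<close> at which
      \<open>g\<close> is non-negative. There \<open>g\<close> vanishes, so its positive slope
      contradicts the negative values just to the right.\<close>
    define S where "S = {c..y} \<inter> g -` {0..}"
    have "closed S" unfolding S_def
      using y by (intro continuous_closed_preimage continuous_on_subset[OF cont]) auto
    moreover have "S \<noteq> {}" "bdd_above S" "S \<subseteq> {c..y}"
      using gc y by (auto simp: S_def)
    ultimately have "Sup S \<in> S" and up: "\<And>t. t \<in> S \<Longrightarrow> t \<le> Sup S"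
      using closed_contains_Sup cSup_upper by metis+
    define s where "s = Sup S"
    have s: "s \<in> {c..y}" "0 \<le> g s" using \<open>Sup S \<in> S\<close> by (auto simp: S_def s_def)
    have neg: "g t < 0" if "s < t" "t \<le> y" for t
      using up[of t] that s(1) by (force simp: S_def s_def)
    have "s < y" using s gy by (cases "s = y") auto
    have "\<exists>t\<in>{s..y}. g t = 0"
    proof -
      have "\<exists>t\<ge>s. t \<le> y \<and> g t = 0"
        using gy s y by (intro IVT2' continuous_on_subset[OF cont]) auto
      then show ?thesis by auto
    qed
    then have gs: "g s = 0" using neg by (metis atLeastAtMost_iff less_irrefl order_le_imp_less_or_eq)
    obtain d where d: "d > 0" "\<And>h. 0 < h \<Longrightarrow> s + h \<in> {c..e} \<Longrightarrow> h < d \<Longrightarrow> g s < g (s + h)"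
      using has_real_derivative_pos_inc_right[OF der[of s] pos[of s]] s(1) y gs by auto
    define h where "h = min (d / 2) (y - s)"
    have "0 < h" "h < d" "s + h \<le> y" using d(1) \<open>s < y\<close> by (auto simp: h_def min_def)
    then show False using d(2)[of h] neg[of "s + h"] gs s(1) y by auto
  qed
  show ?thesis
  proof (rule ccontr)
    assume "\<not> 0 < g x"
    then have gx: "g x = 0" using nonneg[of x] x by auto
    obtain d where d: "d > 0" "\<And>h. 0 < h \<Longrightarrow> x - h \<in> {c..e} \<Longrightarrow> h < d \<Longrightarrow> g (x - h) < g x"
      using has_real_derivative_pos_inc_left[OF der[of x] pos[of x]] x gx by auto
    define h where "h = min (d / 2) (x - c)"
    have "0 < h" "h < d" "c \<le> x - h" using d(1) x by (auto simp: h_def min_def)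
    then show False using d(2)[of h] nonneg[of "x - h"] gx x by auto
  qed
qed

lemma sin_squared_lipschitz: "\<bar>(sin y)\<^sup>2 - (sin z)\<^sup>2\<bar> \<le> \<bar>y - z\<bar>" for y z :: real
proof -
  have "(sin y)\<^sup>2 - (sin z)\<^sup>2 = sin (y - z) * sin (y + z)"
    unfolding sin_add sin_diff using sin_cos_squared_add[of y] sin_cos_squared_add[of z] by algebra
  then have "\<bar>(sin y)\<^sup>2 - (sin z)\<^sup>2\<bar> \<le> \<bar>sin (y - z)\<bar> * 1"
    by (simp add: abs_mult mult_left_le)
  then show ?thesis using abs_sin_x_le_abs_x[of "y - z"] by simp
qed

section \<open>The Pruefer equation\<close>

text \<open>This is \<open>\<theta>' = A cos\<^sup>2 \<theta> + B sin\<^sup>2 \<theta>\<close> with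
  the cosine eliminated; a bound on \<open>B - A\<close> is then a Lipschitz constant in the
  angle.\<close>

definition prufer_on :: "real \<Rightarrow> real \<Rightarrow> (real \<Rightarrow> real) \<Rightarrow> (real \<Rightarrow> real) \<Rightarrow> (real \<Rightarrow> real) \<Rightarrow> bool" where
  "prufer_on a b A B \<theta> \<longleftrightarrow>
    (\<forall>x\<in>{a..b}. (\<theta> has_real_derivative A x + (B x - A x) * (sin (\<theta> x))\<^sup>2) (at x within {a..b}))"

lemma prufer_onD:
  "prufer_on a b A B \<theta> \<Longrightarrow> x \<in> {a..b} \<Longrightarrow>
    (\<theta> has_real_derivative A x + (B x - A x) * (sin (\<theta> x))\<^sup>2) (at x within {a..b})"
  by (simp add: prufer_on_def)

lemma prufer_on_subinterval:
  assumes "prufer_on a b A B \<theta>" "a \<le> c" "d \<le> b"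
  shows "prufer_on c d A B \<theta>"
  unfolding prufer_on_def using assms
  by (auto intro!: DERIV_subset[OF prufer_onD[OF assms(1)]])

lemma prufer_on_continuous: "prufer_on a b A B \<theta> \<Longrightarrow> continuous_on {a..b} \<theta>"
  by (rule DERIV_continuous_on) (rule prufer_onD)

lemma continuous_on_Icc_bounded:
  fixes f :: "real \<Rightarrow> 'a::real_normed_vector"
  assumes "continuous_on {a..b} f"
  obtains K where "K > 0" "\<And>x. x \<in> {a..b} \<Longrightarrow> norm (f x) \<le> K"
  using compact_imp_bounded[OF compact_continuous_image[OF assms]] that
  by (auto simp: bounded_pos)

lemma prufer_on_exists:
  assumes "a \<le> b" "continuous_on {a..b} A" "continuous_on {a..b} B"
  shows "\<exists>\<theta>. \<theta> a = y0 \<and> prufer_on a b A B \<theta>"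
proof -
  obtain K where K: "K > 0" "\<And>x. x \<in> {a..b} \<Longrightarrow> norm (B x - A x) \<le> K"
    using continuous_on_Icc_bounded[OF continuous_on_diff[OF assms(3,2)]] by metis
  have lip: "\<bar>(A t + (B t - A t) * (sin y)\<^sup>2) - (A t + (B t - A t) * (sin z)\<^sup>2)\<bar> \<le> K * \<bar>y - z\<bar>"
    if "t \<in> {a..b}" for t y z
  proof -
    have "\<bar>(A t + (B t - A t) * (sin y)\<^sup>2) - (A t + (B t - A t) * (sin z)\<^sup>2)\<bar>
        = \<bar>B t - A t\<bar> * \<bar>(sin y)\<^sup>2 - (sin z)\<^sup>2\<bar>"
      by (simp add: abs_mult[symmetric] right_diff_distrib)
    also have "\<dots> \<le> K * \<bar>y - z\<bar>"
      using K(1) K(2)[OF that] by (intro mult_mono sin_squared_lipschitz) auto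
    finally show ?thesis .
  qed
  have cont: "continuous_on ({a..b} \<times> UNIV) (\<lambda>(t, y). A t + (B t - A t) * (sin y)\<^sup>2)"
  proof -
    have "continuous_on ({a..b} \<times> UNIV) (\<lambda>z. C (fst z))" if "continuous_on {a..b} C" for C :: "real \<Rightarrow> real"
      by (rule continuous_on_compose2[OF that]) (auto intro: continuous_intros)
    from this[OF assms(2)] this[OF assms(3)] show ?thesis
      unfolding case_prod_beta by (intro continuous_intros)
  qed
  from picard_global[OF assms(1) K(1) cont lip] show ?thesis
    unfolding prufer_on_def by metis
qed

text \<open>At a multiple of pi the sine vanishes and the slope is \<open>A x\<close>, positive
  whatever the sign of \<open>B\<close>. Hence the barrier lemma applies at every such
  level.\<close>

lemma prufer_on_above:
  assumes "prufer_on c e A B \<theta>" and A: "\<And>x. x \<in> {c..e} \<Longrightarrow> 0 < A x"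
    and "of_int k * pi \<le> \<theta> c" "c < x" "x \<le> e"
  shows "of_int k * pi < \<theta> x"
proof -
  have "0 < \<theta> x - of_int k * pi"
  proof (rule pos_if_deriv_pos_at_zeros[where g = "\<lambda>x. \<theta> x - of_int k * pi"])
    show "((\<lambda>x. \<theta> x - of_int k * pi) has_real_derivative A x + (B x - A x) * (sin (\<theta> x))\<^sup>2) (at x within {c..e})"
      if "x \<in> {c..e}" for x
      using prufer_onD[OF assms(1) that] by (auto intro!: derivative_eq_intros)
    show "0 < A x + (B x - A x) * (sin (\<theta> x))\<^sup>2" if "x \<in> {c..e}" "\<theta> x - of_int k * pi = 0" for x
    proof -
      have "sin (\<theta> x) = 0" using that(2) by (auto simp: sin_zero_iff_int2)
      then show ?thesis using A[OF that(1)] by simp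
    qed
  qed (use assms in auto)
  then show ?thesis by simp
qed

section \<open>Comparison of two Pruefer angles with ordered coefficients\<close>

context
  fixes a b K :: real and A B1 B2 \<theta>1 \<theta>2 :: "real \<Rightarrow> real"
  assumes \<theta>1: "prufer_on a b A B1 \<theta>1" and \<theta>2: "prufer_on a b A B2 \<theta>2"
    and le: "\<And>x. x \<in> {a..b} \<Longrightarrow> B1 x \<le> B2 x"
    and K: "\<And>x. x \<in> {a..b} \<Longrightarrow> \<bar>B2 x - A x\<bar> \<le> K"
    and init: "\<theta>1 a < \<theta>2 a"
begin

text \<open>\<open>E\<close> is Lipschitz in the gap between the angles and \<open>H\<close> is the
  non-negative forcing from \<open>B2 - B1\<close>. The one-sided bound serves monotonicity, the
  two-sided one continuity.\<close>

lemma prufer_difference_deriv: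
  fixes x
  defines "E \<equiv> (B2 x - A x) * ((sin (\<theta>2 x))\<^sup>2 - (sin (\<theta>1 x))\<^sup>2)"
    and "H \<equiv> (B2 x - B1 x) * (sin (\<theta>1 x))\<^sup>2"
  assumes x: "x \<in> {a..b}"
  shows "((\<lambda>x. \<theta>2 x - \<theta>1 x) has_real_derivative E + H) (at x within {a..b})"
    and "\<bar>E + H\<bar> \<le> K * \<bar>\<theta>2 x - \<theta>1 x\<bar> + (B2 x - B1 x)"
    and "E + H \<ge> - K * \<bar>\<theta>2 x - \<theta>1 x\<bar>"
proof -
  show "((\<lambda>x. \<theta>2 x - \<theta>1 x) has_real_derivative E + H) (at x within {a..b})"
    by (rule DERIV_cong[OF DERIV_diff[OF prufer_onD[OF \<theta>2 x] prufer_onD[OF \<theta>1 x]]])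
      (simp add: E_def H_def algebra_simps)
  have "\<bar>E\<bar> \<le> K * \<bar>\<theta>2 x - \<theta>1 x\<bar>"
    unfolding E_def abs_mult using K[OF x] by (intro mult_mono sin_squared_lipschitz) auto
  moreover have "0 \<le> H" using le[OF x] by (simp add: H_def)
  moreover have "H \<le> B2 x - B1 x"
    unfolding H_def using le[OF x] abs_square_le_1[of "sin (\<theta>1 x)"] by (intro mult_left_le) auto
  ultimately show "\<bar>E + H\<bar> \<le> K * \<bar>\<theta>2 x - \<theta>1 x\<bar> + (B2 x - B1 x)"
    "E + H \<ge> - K * \<bar>\<theta>2 x - \<theta>1 x\<bar>"
    by (auto simp: abs_le_iff)
qed

text \<open>A lower Gronwall bound: the gap stays above a decaying exponential. The rate
  \<open>K + 1\<close> instead of \<open>K\<close> leaves a strict inequality at a contact point, as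
  the barrier lemma demands.\<close>

lemma prufer_on_strict_mono:
  assumes "x \<in> {a..b}"
  shows "\<theta>1 x < \<theta>2 x"
proof (cases "x = a")
  case False
  define D where "D x = (B2 x - A x) * ((sin (\<theta>2 x))\<^sup>2 - (sin (\<theta>1 x))\<^sup>2)
    + (B2 x - B1 x) * (sin (\<theta>1 x))\<^sup>2" for x
  note D = prufer_difference_deriv[folded D_def]
  define d where "d = \<theta>2 a - \<theta>1 a"
  have d: "d > 0" using init by (simp add: d_def)
  define E where "E x = d * exp (- (K + 1) * (x - a))" for x
  have E: "E x > 0" for x using d by (simp add: E_def)
  have E': "(E has_real_derivative - (K + 1) * E x) (at x within {a..b})" for x
    unfolding E_def by (auto intro!: derivative_eq_intros)
  have "0 < (\<theta>2 x - \<theta>1 x) - E x"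
  proof (rule pos_if_deriv_pos_at_zeros[where g = "\<lambda>x. \<theta>2 x - \<theta>1 x - E x"])
    show "((\<lambda>x. \<theta>2 x - \<theta>1 x - E x) has_real_derivative D x + (K + 1) * E x) (at x within {a..b})"
      if "x \<in> {a..b}" for x
      by (rule DERIV_cong[OF DERIV_diff[OF D(1)[OF that] E']]) (simp add: algebra_simps)
    show "0 < D x + (K + 1) * E x" if "x \<in> {a..b}" "\<theta>2 x - \<theta>1 x - E x = 0" for x
      using D(3)[OF that(1)] that(2) E[of x] by (simp add: algebra_simps)
  qed (use assms False in \<open>auto simp: E_def d_def\<close>)
  then show ?thesis using E[of x] by simp
qed (simp add: init)

lemma prufer_on_difference_le:
  assumes x: "x \<in> {a..b}" and \<eta>: "\<And>x. x \<in> {a..b} \<Longrightarrow> B2 x - B1 x \<le> \<eta>" "\<eta> \<ge> 0" and "K \<ge> 0"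
  shows "\<theta>2 x - \<theta>1 x \<le> (\<theta>2 a - \<theta>1 a + \<eta>) * exp ((K + 1) * (x - a))"
proof (cases "x = a")
  case False
  define D where "D x = (B2 x - A x) * ((sin (\<theta>2 x))\<^sup>2 - (sin (\<theta>1 x))\<^sup>2)
    + (B2 x - B1 x) * (sin (\<theta>1 x))\<^sup>2" for x
  note D = prufer_difference_deriv[folded D_def]
  \<comment> \<open>Adding \<eta> to the initial gap keeps \<open>E\<close> above \<eta>, so at a
    contact point the extra \<open>E x\<close> in the slope \<open>(K + 1) * E x\<close> outweighs
    the forcing.\<close>
  define d where "d = \<theta>2 a - \<theta>1 a + \<eta>"
  have d: "d > \<eta>" using init by (simp add: d_def)
  define E where "E x = d * exp ((K + 1) * (x - a))" for x
  have E: "E x \<ge> d" if "x \<ge> a" for x using d \<eta>(2) \<open>K \<ge> 0\<close> that by (simp add: E_def)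
  have E': "(E has_real_derivative (K + 1) * E x) (at x within {a..b})" for x
    unfolding E_def by (auto intro!: derivative_eq_intros)
  have "0 < E x - (\<theta>2 x - \<theta>1 x)"
  proof (rule pos_if_deriv_pos_at_zeros[where g = "\<lambda>x. E x - (\<theta>2 x - \<theta>1 x)"])
    show "((\<lambda>x. E x - (\<theta>2 x - \<theta>1 x)) has_real_derivative (K + 1) * E x - D x) (at x within {a..b})"
      if "x \<in> {a..b}" for x
      by (rule DERIV_diff[OF E' D(1)[OF that]])
    show "0 < (K + 1) * E x - D x" if "x \<in> {a..b}" "E x - (\<theta>2 x - \<theta>1 x) = 0" for x
    proof -
      have "E x \<ge> d" using E[of x] that(1) by simp
      then have "\<theta>2 x - \<theta>1 x = E x" "E x > \<eta>" "E x > 0" using that(2) d \<eta>(2) by auto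
      then show ?thesis using D(2)[OF that(1)] \<eta>(1)[OF that(1)] by (simp add: algebra_simps)
    qed
  qed (use assms False in \<open>auto simp: E_def d_def\<close>)
  then show ?thesis by (simp add: E_def d_def)
qed (use \<eta> in simp)

end

text \<open>With constant coefficients \<open>m\<close> and \<open>M\<close> the angle advances by
  pi over a length \<open>pi / sqrt (m * M)\<close>, and larger coefficients turn it at least as
  fast. Otherwise the angle would stay strictly between two consecutive multiples of pi, where its
  cotangent is finite.\<close>

lemma prufer_on_oscillation:
  assumes \<theta>: "prufer_on c d A B \<theta>" and "c < d"
    and m: "0 < m" "\<And>x. x \<in> {c..d} \<Longrightarrow> m \<le> A x"
    and M: "0 < M" "\<And>x. x \<in> {c..d} \<Longrightarrow> M \<le> B x"
    and init: "of_int k * pi < \<theta> c"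
    and long: "pi \<le> sqrt (m * M) * (d - c)"
  shows "of_int (k + 1) * pi \<le> \<theta> d"
proof (rule ccontr)
  assume less: "\<not> of_int (k + 1) * pi \<le> \<theta> d"
  have A: "0 < A x" if "x \<in> {c..d}" for x using m(1) m(2)[OF that] by simp
  have lo: "of_int k * pi < \<theta> x" if "x \<in> {c..d}" for x
    using prufer_on_above[OF \<theta> A, of k x] init that by (cases "x = c") auto
  have up: "\<theta> x < of_int (k + 1) * pi" if "x \<in> {c..d}" for x
  proof (rule ccontr)
    assume ge: "\<not> \<theta> x < of_int (k + 1) * pi"
    then have "of_int (k + 1) * pi < \<theta> d" if "x < d"
      using prufer_on_above[OF prufer_on_subinterval[OF \<theta>, of x d] A, of "k + 1" d] \<open>x \<in> {c..d}\<close> that by auto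
    then show False using less ge that by (cases "x = d") auto
  qed
  have sin: "sin (\<theta> x) \<noteq> 0" if x: "x \<in> {c..d}" for x
  proof
    assume "sin (\<theta> x) = 0"
    then obtain i :: int where i: "\<theta> x = of_int i * pi" by (auto simp: sin_zero_iff_int2)
    have "real_of_int k < of_int i" "real_of_int i < of_int (k + 1)"
      using lo[OF x] up[OF x] unfolding i by (auto simp: mult_less_cancel_right)
    then show False unfolding of_int_less_iff by linarith
  qed
  \<comment> \<open>This scaling gives \<open>m y\<^sup>2 + M = M (1 + (s y)\<^sup>2)\<close>, which
    cancels the denominator in the derivative of \<open>arctan (s y)\<close>.\<close>
  define s where "s = sqrt (m / M)"
  have s: "s > 0" "s\<^sup>2 = m / M" using m(1) M(1) by (auto simp: s_def)
  have sM: "sqrt (m * M) = M * s" using m(1) M(1)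
    by (simp add: s_def real_sqrt_mult real_sqrt_divide field_simps)
  \<comment> \<open>The Riccati variable \<open>y = cot \<theta>\<close> satisfies \<open>y' \<le> - (m y\<^sup>2 + M)\<close>, so \<open>arctan (s y)\<close> decreases at
     a rate of at least \<open>sqrt (m M)\<close>, while its range has length less than \<open>\<pi>\<close>.\<close>
  define g where "g x = arctan (s * cot (\<theta> x)) + M * s * (x - c)" for x
  have "g d \<le> g c"
  proof (rule DERIV_nonpos_imp_decreasing_open[where f = g])
    show "c \<le> d" using \<open>c < d\<close> by simp
    show "continuous_on {c..d} g" unfolding g_def
      by (intro continuous_intros prufer_on_continuous[OF \<theta>]) (use sin in auto)
    fix x assume x: "c < x" "x < d"
    define S where "S = (sin (\<theta> x))\<^sup>2"
    define D where "D = A x + (B x - A x) * S"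
    have xI: "x \<in> {c..d}" using x by simp
    have der: "(\<theta> has_real_derivative D) (at x)"
      using prufer_onD[OF \<theta> xI] x by (simp add: at_within_Icc_at D_def S_def)
    have S: "0 < S" "S \<le> 1" using sin[OF xI] by (auto simp: S_def abs_square_le_1)
    have C: "(cot (\<theta> x))\<^sup>2 = (1 - S) / S"
      unfolding cot_def power_divide S_def by (simp add: cos_squared_eq)
    let ?y = "cot (\<theta> x)"
    have cot': "((\<lambda>x. cot (\<theta> x)) has_real_derivative - D / S) (at x)"
      using DERIV_chain2[OF DERIV_cot[OF sin[OF xI]] der] by (simp add: S_def field_simps)
    have g': "(g has_real_derivative (s * (- D / S)) / (1 + (s * ?y)\<^sup>2) + M * s) (at x)"
      unfolding g_def by (rule derivative_eq_intros cot' refl | simp add: divide_inverse)+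
    have "m * (1 - S) + M * S \<le> A x * (1 - S) + B x * S"
      using m(2)[OF xI] M(2)[OF xI] S by (intro add_mono mult_right_mono) auto
    also have "\<dots> = D" by (simp add: D_def algebra_simps)
    finally have D: "m * (1 - S) + M * S \<le> D" .
    have "M * (1 + (s * ?y)\<^sup>2) = (m * (1 - S) + M * S) / S"
      unfolding power_mult_distrib s(2) C using S(1) M(1) by (simp add: field_simps)
    also have "\<dots> \<le> D / S" using D S(1) by (simp add: divide_right_mono)
    finally have "M \<le> D / S / (1 + (s * ?y)\<^sup>2)"
      by (subst pos_le_divide_eq) (auto intro: add_pos_nonneg)
    then have "M * s \<le> D / S / (1 + (s * ?y)\<^sup>2) * s"
      using s(1) by (intro mult_right_mono) auto
    then have "(s * (- D / S)) / (1 + (s * ?y)\<^sup>2) + M * s \<le> 0" by (simp add: mult_ac)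
    then show "\<exists>y. (g has_real_derivative y) (at x) \<and> y \<le> 0" using g' by blast
  qed
  then have "arctan (s * cot (\<theta> d)) + M * s * (d - c) \<le> arctan (s * cot (\<theta> c))"
    by (simp add: g_def)
  then show False
    using long arctan_bounded[of "s * cot (\<theta> d)"] arctan_bounded[of "s * cot (\<theta> c)"]
    unfolding sM by linarith
qed

text \<open>The energy \<open>N\<close>, the sum of the squared moduli of \<open>f\<close> and
  \<open>V\<close>, satisfies \<open>N' \<le> K * N\<close>. Starting from zero, it stays below
  every positive multiple of an exponential. By linearity this is uniqueness for initial value
  problems.\<close>

lemma linear_system_zero:
  fixes f V :: "real \<Rightarrow> complex" and c h :: "real \<Rightarrow> complex"
  assumes c: "continuous_on {a..b} c" and h: "continuous_on {a..b} h"
    and f: "\<And>x. x \<in> {a..b} \<Longrightarrow> (f has_vector_derivative c x * V x) (at x within {a..b})"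
    and V: "\<And>x. x \<in> {a..b} \<Longrightarrow> (V has_vector_derivative h x * f x) (at x within {a..b})"
    and init: "f a = 0" "V a = 0" and x: "x \<in> {a..b}"
  shows "f x = 0 \<and> V x = 0"
proof (cases "x = a")
  case False
  obtain K1 where K1: "K1 > 0" "\<And>x. x \<in> {a..b} \<Longrightarrow> norm (c x) \<le> K1"
    using continuous_on_Icc_bounded[OF c] by metis
  obtain K2 where K2: "K2 > 0" "\<And>x. x \<in> {a..b} \<Longrightarrow> norm (h x) \<le> K2"
    using continuous_on_Icc_bounded[OF h] by metis
  define K where "K = K1 + K2"
  define N where "N x = f x \<bullet> f x + V x \<bullet> V x" for x
  define N' where "N' x = 2 * (f x \<bullet> (c x * V x)) + 2 * (V x \<bullet> (h x * f x))" for x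
  have N: "(N has_real_derivative N' x) (at x within {a..b})" if "x \<in> {a..b}" for x
  proof -
    have "(N has_derivative (\<lambda>t. t * N' x)) (at x within {a..b})"
      unfolding N_def N'_def using f[OF that] V[OF that] unfolding has_vector_derivative_def
      by (auto intro!: derivative_eq_intros simp: inner_commute algebra_simps)
    then show ?thesis by (simp add: has_field_derivative_def mult_commute_abs)
  qed
  have N'_le: "N' x \<le> K * N x" if x: "x \<in> {a..b}" for x
  proof -
    have am: "2 * (norm (f x) * norm (V x)) \<le> N x"
      using sum_squares_bound[of "norm (f x)" "norm (V x)"] by (simp add: N_def dot_square_norm)
    have "f x \<bullet> (c x * V x) \<le> norm (f x) * (K1 * norm (V x))"
      by (rule order_trans[OF norm_cauchy_schwarz])
        (auto simp: norm_mult intro!: mult_left_mono mult_right_mono K1 x)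
    moreover have "V x \<bullet> (h x * f x) \<le> norm (V x) * (K2 * norm (f x))"
      by (rule order_trans[OF norm_cauchy_schwarz])
        (auto simp: norm_mult intro!: mult_left_mono mult_right_mono K2 x)
    ultimately have "N' x \<le> K * (2 * (norm (f x) * norm (V x)))"
      by (simp add: N'_def K_def algebra_simps)
    also have "\<dots> \<le> K * N x" using am K1 K2 by (intro mult_left_mono) (auto simp: K_def)
    finally show ?thesis .
  qed
  have less: "N x < \<epsilon> * exp ((K + 1) * (x - a))" if "\<epsilon> > 0" for \<epsilon>
  proof -
    define E where "E x = \<epsilon> * exp ((K + 1) * (x - a))" for x
    have E': "(E has_real_derivative (K + 1) * E x) (at x within {a..b})" for x
      unfolding E_def by (auto intro!: derivative_eq_intros)
    have "0 < E x - N x"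
    proof (rule pos_if_deriv_pos_at_zeros[where g = "\<lambda>x. E x - N x"])
      show "((\<lambda>x. E x - N x) has_real_derivative (K + 1) * E x - N' x) (at x within {a..b})"
        if "x \<in> {a..b}" for x by (rule DERIV_diff[OF E' N[OF that]])
      show "0 < (K + 1) * E x - N' x" if "x \<in> {a..b}" "E x - N x = 0" for x
      proof -
        have "E x > 0" using \<open>\<epsilon> > 0\<close> by (simp add: E_def)
        then show ?thesis using N'_le[OF that(1)] that(2) by (simp add: algebra_simps)
      qed
      show "0 \<le> E a - N a" using init \<open>\<epsilon> > 0\<close> by (simp add: E_def N_def)
    qed (use x False in auto)
    then show ?thesis by (simp add: E_def)
  qed
  have "N x \<le> 0"
  proof (rule ccontr)
    assume "\<not> N x \<le> 0"
    then have "N x / exp ((K + 1) * (x - a)) > 0" by simp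
    from less[OF this] show False by simp
  qed
  moreover have "0 \<le> f x \<bullet> f x" "0 \<le> V x \<bullet> V x" by simp_all
  ultimately have "f x \<bullet> f x = 0" "V x \<bullet> V x = 0" unfolding N_def by linarith+
  then show ?thesis by simp
qed (simp add: init)

text \<open>The angle \<open>pi / 2 + arctan t\<close> has cotangent \<open>- t\<close>, and angles
  with equal cotangent differ by a multiple of pi. This translates both boundary conditions into
  conditions on the angle.\<close>

lemma sin_diff_arctan_zero_iff: "sin (y - (pi / 2 + arctan t)) = 0 \<longleftrightarrow> cos y = - t * sin y"
proof -
  have "sin (y - (pi / 2 + arctan t)) = - cos (y - arctan t)"
    using sin_diff[of "y - arctan t" "pi / 2"] by (simp add: diff_diff_eq add.commute)
  also have "\<dots> = - cos (arctan t) * (cos y + t * sin y)"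
    using tan_arctan[of t] cos_arctan_not_zero[of t]
    by (simp add: cos_diff tan_def field_simps)
  finally have "sin (y - (pi / 2 + arctan t)) = 0 \<longleftrightarrow> cos y + t * sin y = 0"
    using cos_arctan_not_zero[of t] by simp
  then show ?thesis by (simp add: eq_neg_iff_add_eq_0)
qed

section \<open>Sturm-Liouville problems with the eigenvalue in the boundary conditions\<close>

text \<open>The parameters stand for \<open>(P f')' = (q - \<lambda> w) f\<close> with
  \<open>P f' = (\<alpha> - \<lambda> F) f\<close> at \<open>a\<close> and
  \<open>P f' = - (\<beta> - \<lambda> G) f\<close> at \<open>b\<close>. The weight may have zeros,
  as long as it is positive somewhere in every subinterval.\<close>

locale sturm_liouville =
  fixes a b \<alpha> \<beta> F G :: real and P q w :: "real \<Rightarrow> real"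
  assumes ab: "a < b"
    and P_cont: "continuous_on {a..b} P" and P_pos: "\<And>x. x \<in> {a..b} \<Longrightarrow> 0 < P x"
    and q_cont: "continuous_on {a..b} q" and q_pos: "\<And>x. x \<in> {a..b} \<Longrightarrow> 0 < q x"
    and w_cont: "continuous_on {a..b} w" and w_nonneg: "\<And>x. x \<in> {a..b} \<Longrightarrow> 0 \<le> w x"
    and w_pos_dense: "\<And>c d. a \<le> c \<Longrightarrow> c < d \<Longrightarrow> d \<le> b \<Longrightarrow> \<exists>x\<in>{c<..<d}. 0 < w x"
    and \<alpha>: "0 < \<alpha>" and \<beta>: "0 < \<beta>" and F: "0 < F" and G: "0 < G"
begin

abbreviation A where "A x \<equiv> 1 / P x"
abbreviation B where "B lam x \<equiv> lam * w x - q x"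

lemma A_cont: "continuous_on {a..b} A"
  using P_pos by (intro continuous_intros P_cont) force

lemma A_pos: "x \<in> {a..b} \<Longrightarrow> 0 < A x"
  using P_pos by simp

lemma B_cont: "continuous_on {a..b} (B lam)"
  by (intro continuous_intros w_cont q_cont)

section \<open>The Pruefer angle as a function of the spectral parameter\<close>

definition angle :: "real \<Rightarrow> real \<Rightarrow> real" where
  "angle lam = (SOME \<theta>. \<theta> a = pi / 2 - arctan (\<alpha> - lam * F) \<and> prufer_on a b A (B lam) \<theta>)"

text \<open>The initial value is the angle in (0, pi) with cotangent
  \<open>\<alpha> - lam * F\<close>, so it encodes the left boundary condition.\<close>

lemma angle_init: "angle lam a = pi / 2 - arctan (\<alpha> - lam * F)"
  and angle_prufer: "prufer_on a b A (B lam) (angle lam)"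
  using someI_ex[OF prufer_on_exists[OF less_imp_le[OF ab] A_cont B_cont]]
  unfolding angle_def by blast+

lemma angle_init_bounds: "0 < angle lam a" "angle lam a < pi"
  using arctan_bounded[of "\<alpha> - lam * F"] by (auto simp: angle_init)

lemma angle_above:
  assumes "of_int k * pi \<le> angle lam c" "a \<le> c" "c < x" "x \<le> b"
  shows "of_int k * pi < angle lam x"
  by (rule prufer_on_above[OF prufer_on_subinterval[OF angle_prufer] A_pos, of c b])
    (use assms in auto)

lemma angle_pos: "x \<in> {a..b} \<Longrightarrow> 0 < angle lam x"
  using angle_above[of 0 lam a x] angle_init_bounds[of lam] by (cases "x = a") auto

text \<open>Without the weight term the slope at angle pi/2 is \<open>- q\<close>, so this level is
  a barrier from above, and \<open>\<alpha> > 0\<close> starts the angle below it.\<close>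

lemma angle_0_less: "angle 0 b < pi / 2"
proof -
  have "0 < pi / 2 - angle 0 b"
  proof (rule pos_if_deriv_pos_at_zeros[where g = "\<lambda>x. pi / 2 - angle 0 x"])
    show "((\<lambda>x. pi / 2 - angle 0 x) has_real_derivative
        - (A x + (B 0 x - A x) * (sin (angle 0 x))\<^sup>2)) (at x within {a..b})" if "x \<in> {a..b}" for x
      using DERIV_diff[OF DERIV_const prufer_onD[OF angle_prufer that], of "pi / 2" 0] by simp
    show "0 < - (A x + (B 0 x - A x) * (sin (angle 0 x))\<^sup>2)"
      if "x \<in> {a..b}" "pi / 2 - angle 0 x = 0" for x
    proof -
      have "sin (angle 0 x) = 1" using that(2) sin_pi_half by (metis right_minus_eq)
      then show ?thesis using q_pos[OF that(1)] by simp
    qed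
    show "0 \<le> pi / 2 - angle 0 a" using \<alpha> by (simp add: angle_init)
  qed (use ab in auto)
  then show ?thesis by simp
qed

text \<open>Raising the parameter raises \<open>B\<close> because \<open>w\<close> is non-negative,
  and raises the initial angle strictly because \<open>F\<close> is positive; the comparison lemma
  propagates the strict gap.\<close>

lemma angle_strict_mono:
  assumes "l1 < l2" "x \<in> {a..b}" shows "angle l1 x < angle l2 x"
proof -
  obtain K where K: "\<And>x. x \<in> {a..b} \<Longrightarrow> norm (B l2 x - A x) \<le> K"
    using continuous_on_Icc_bounded[OF continuous_on_diff[OF B_cont A_cont]] by metis
  show ?thesis
  proof (rule prufer_on_strict_mono[OF angle_prufer angle_prufer])
    show "B l1 x \<le> B l2 x" if "x \<in> {a..b}" for x
      using w_nonneg[OF that] assms(1) by (simp add: mult_right_mono)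
    show "\<bar>B l2 x - A x\<bar> \<le> K" if "x \<in> {a..b}" for x using K[OF that] by simp
    show "angle l1 a < angle l2 a" using F assms(1) by (simp add: angle_init arctan_less_iff)
  qed fact
qed

lemma angle_continuous: "continuous_on UNIV (\<lambda>lam. angle lam b)"
proof -
  obtain W where W: "W > 0" "\<And>x. x \<in> {a..b} \<Longrightarrow> norm (w x) \<le> W"
    using continuous_on_Icc_bounded[OF w_cont] by metis
  obtain Kq where Kq: "Kq > 0" "\<And>x. x \<in> {a..b} \<Longrightarrow> norm (- q x - A x) \<le> Kq"
    using continuous_on_Icc_bounded[of a b "\<lambda>x. - q x - A x"]
      continuous_on_diff[OF continuous_on_minus[OF q_cont] A_cont] by metis
  \<comment> \<open>\<open>C\<close> is the Gronwall factor, and \<open>M\<close> bounds the initial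
    gap plus the forcing symmetrically in both parameters. The sum \<open>C l + C l0\<close> then
    covers both orderings of \<open>l\<close> and \<open>l0\<close>.\<close>
  define C where "C lam = exp ((\<bar>lam\<bar> * W + Kq + 1) * (b - a))" for lam :: real
  define M where "M l0 l = \<bar>angle l a - angle l0 a\<bar> + \<bar>l - l0\<bar> * W" for l0 l
  have est: "angle l2 b - angle l1 b \<le> (angle l2 a - angle l1 a + (l2 - l1) * W) * C l2"
    if "l1 < l2" for l1 l2
    unfolding C_def
  proof (rule prufer_on_difference_le[OF angle_prufer angle_prufer])
    show "B l1 x \<le> B l2 x" "B l2 x - B l1 x \<le> (l2 - l1) * W" "\<bar>B l2 x - A x\<bar> \<le> \<bar>l2\<bar> * W + Kq"
      if x: "x \<in> {a..b}" for x
    proof -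
      show "B l1 x \<le> B l2 x" using w_nonneg[OF x] \<open>l1 < l2\<close> by (simp add: mult_right_mono)
      have "(l2 - l1) * w x \<le> (l2 - l1) * W" using W(2)[OF x] \<open>l1 < l2\<close> by (intro mult_left_mono) auto
      then show "B l2 x - B l1 x \<le> (l2 - l1) * W" by (simp add: algebra_simps)
      have "\<bar>l2 * w x\<bar> \<le> \<bar>l2\<bar> * W" unfolding abs_mult using W(2)[OF x] by (intro mult_left_mono) auto
      then show "\<bar>B l2 x - A x\<bar> \<le> \<bar>l2\<bar> * W + Kq" using Kq(2)[OF x] by simp
    qed
    show "angle l1 a < angle l2 a" using angle_strict_mono[OF that, of a] ab by simp
  qed (use ab W(1) Kq(1) that in auto)
  have "((\<lambda>l. angle l b) \<longlongrightarrow> angle l0 b) (at l0)" for l0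
  proof -
    have "\<forall>\<^sub>F l in at l0. norm (angle l b - angle l0 b) \<le> M l0 l * (C l + C l0)"
    proof (rule eventuallyI)
      fix l
      have CM: "0 \<le> C l" "0 \<le> C l0" "0 \<le> M l0 l" using W(1) by (auto simp: C_def M_def)
      show "norm (angle l b - angle l0 b) \<le> M l0 l * (C l + C l0)"
      proof (cases l0 l rule: linorder_cases)
        case less
        have "norm (angle l b - angle l0 b) \<le> M l0 l * C l"
          using est[OF less] angle_strict_mono[OF less, of a] angle_strict_mono[OF less, of b] ab less
          by (simp add: M_def)
        then show ?thesis using CM by (simp add: distrib_left add_increasing2)
      next
        case greater
        have "norm (angle l b - angle l0 b) \<le> M l0 l * C l0"
          using est[OF greater] angle_strict_mono[OF greater, of a] angle_strict_mono[OF greater, of b] ab greater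
          by (simp add: M_def)
        then show ?thesis using CM by (simp add: distrib_left add_increasing)
      qed (use CM in auto)
    qed
    moreover have "isCont (\<lambda>l. M l0 l * (C l + C l0)) l0"
      unfolding M_def C_def angle_init by (intro continuous_intros)
    then have "((\<lambda>l. M l0 l * (C l + C l0)) \<longlongrightarrow> 0) (at l0)"
      by (simp add: isCont_def M_def)
    ultimately have "((\<lambda>l. angle l b - angle l0 b) \<longlongrightarrow> 0) (at l0)"
      by (rule Lim_null_comparison)
    then show ?thesis by (simp add: LIM_zero_iff)
  qed
  then show ?thesis by (simp add: continuous_on_def)
qed

text \<open>Each induction step uses up a short interval on which \<open>w\<close> is bounded away
  from zero; for large parameters the angle gains pi there. Leaving \<open>c\<close> and
  \<open>j\<close> general lets the remaining \<open>N\<close> gains take place further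
  right.\<close>

lemma angle_unbounded:
  assumes "a \<le> c" "c < b"
  shows "\<exists>L>0. \<forall>lam\<ge>L. \<forall>j::int. of_int j * pi \<le> angle lam c \<longrightarrow> of_int (j + int N) * pi < angle lam b"
  using assms
proof (induction N arbitrary: c)
  case 0
  then have "\<forall>lam\<ge>1. \<forall>j::int. of_int j * pi \<le> angle lam c \<longrightarrow> of_int (j + int 0) * pi < angle lam b"
    using angle_above[of _ _ c b] by auto
  then show ?case by (intro exI[of _ 1]) auto
next
  case (Suc N)
  obtain x0 where x0: "x0 \<in> {c<..<b}" "0 < w x0" using w_pos_dense[of c b] Suc.prems by auto
  have "isCont w x0"
    using continuous_on_interior[OF w_cont, of x0] x0 Suc.prems by auto
  then obtain r where r: "r > 0" "\<And>x. dist x x0 < r \<Longrightarrow> dist (w x) (w x0) < w x0 / 2"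
    using x0(2) unfolding continuous_at_eps_delta by (metis half_gt_zero)
  define e where "e = min (x0 + r / 2) ((x0 + b) / 2)"
  have e: "x0 < e" "e < b" "e \<le> x0 + r / 2" using r(1) x0 by (auto simp: e_def min_def field_simps)
  have wlow: "w x0 / 2 \<le> w x" if "x \<in> {x0..e}" for x
  proof -
    have "dist (w x) (w x0) < w x0 / 2"
      using that e r(1) by (intro r(2)) (simp add: dist_real_def)
    then show ?thesis unfolding dist_real_def abs_less_iff by simp
  qed
  obtain Pm where Pm: "Pm > 0" "\<And>x. x \<in> {a..b} \<Longrightarrow> norm (P x) \<le> Pm"
    using continuous_on_Icc_bounded[OF P_cont] by metis
  obtain qm where qm: "qm > 0" "\<And>x. x \<in> {a..b} \<Longrightarrow> norm (q x) \<le> qm"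
    using continuous_on_Icc_bounded[OF q_cont] by metis
  define e' where "e' = (e + b) / 2"
  have e': "e < e'" "e' < b" using e by (auto simp: e'_def)
  obtain L where L: "L > 0" "\<And>lam j. lam \<ge> L \<Longrightarrow> of_int j * pi \<le> angle lam e' \<Longrightarrow>
      of_int (j + int N) * pi < angle lam b"
    using Suc.IH[of e'] e e' x0 Suc.prems by auto
  \<comment> \<open>As \<open>1 / Pm\<close> bounds \<open>A\<close> from below, this
    \<open>M\<close> makes \<open>sqrt (M / Pm) * (e - x0)\<close> equal to pi, exactly the length
    condition for a gain of pi.\<close>
  define M where "M = Pm * (pi / (e - x0))\<^sup>2"
  have M: "0 < M" using Pm(1) e by (simp add: M_def)
  \<comment> \<open>Beyond this threshold \<open>lam * w x - q x\<close> is at least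
    \<open>M\<close> on \<open>{x0..e}\<close>, because \<open>w\<close> is at least
    \<open>w x0 / 2\<close> there.\<close>
  define L' where "L' = max L ((M + qm) / (w x0 / 2))"
  have "of_int (j + int (Suc N)) * pi < angle lam b"
    if lam: "lam \<ge> L'" and j: "of_int j * pi \<le> angle lam c" for lam and j :: int
  proof -
    have pos: "lam > 0" "lam \<ge> L" using lam L(1) by (auto simp: L'_def)
    have sub: "{x0..e} \<subseteq> {a..b}" using x0 e Suc.prems by auto
    have "of_int (j + 1) * pi \<le> angle lam e"
    proof (rule prufer_on_oscillation[OF prufer_on_subinterval[OF angle_prufer] \<open>x0 < e\<close>])
      show "0 < 1 / Pm" using Pm by simp
      show "1 / Pm \<le> A x" if "x \<in> {x0..e}" for x
        using Pm(2)[of x] P_pos[of x] that sub by (intro divide_left_mono) auto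
      show "M \<le> B lam x" if "x \<in> {x0..e}" for x
      proof -
        have "M + qm \<le> lam * (w x0 / 2)"
          using lam x0(2) by (simp add: L'_def pos_divide_le_eq)
        also have "\<dots> \<le> lam * w x" using wlow[OF that] pos by (intro mult_left_mono) auto
        finally show ?thesis using qm(2)[of x] that sub by auto
      qed
      show "of_int j * pi < angle lam x0" using angle_above[OF j] x0 Suc.prems by auto
      show "pi \<le> sqrt (1 / Pm * M) * (e - x0)"
        using Pm(1) e by (simp add: M_def real_sqrt_divide)
    qed (use M x0 e Suc.prems in auto)
    from angle_above[OF this, of e'] have "of_int (j + 1) * pi \<le> angle lam e'"
      using x0 e e' Suc.prems by auto
    from L(2)[OF pos(2) this] show ?thesis by (simp add: algebra_simps)
  qed
  moreover have "L' > 0" using L(1) by (simp add: L'_def)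
  ultimately show ?case by blast
qed

section \<open>The right boundary condition and the eigenvalue sequence\<close>

definition target :: "real \<Rightarrow> real" where
  "target lam = pi / 2 + arctan (\<beta> - lam * G)"

text \<open>The right boundary condition holds exactly when this quantity is a multiple of
  pi.\<close>

definition mismatch :: "real \<Rightarrow> real" where
  "mismatch lam = angle lam b - target lam"

lemma target_bounds: "0 < target lam" "target lam < pi"
  using arctan_bounded[of "\<beta> - lam * G"] by (auto simp: target_def)

lemma mismatch_strict_mono: "strict_mono mismatch"
proof (rule strict_monoI)
  fix l1 l2 :: real assume l: "l1 < l2"
  have "target l2 < target l1" using l G by (simp add: target_def arctan_less_iff)
  then show "mismatch l1 < mismatch l2"
    using angle_strict_mono[OF l, of b] ab by (simp add: mismatch_def)
qed

lemma mismatch_continuous: "continuous_on UNIV mismatch"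
  unfolding mismatch_def target_def by (intro continuous_intros angle_continuous)

lemma mismatch_0: "mismatch 0 < 0"
proof -
  have "0 < arctan \<beta>" using \<beta> by (simp add: zero_less_arctan_iff)
  then show ?thesis using angle_0_less unfolding mismatch_def target_def by (simp only: mult_zero_left diff_zero)
qed

text \<open>Excludes the negative multiples of pi, so the numbering of the eigenvalues can start at
  0.\<close>

lemma mismatch_gt: "- pi < mismatch lam"
  using angle_pos[of b lam] target_bounds[of lam] ab by (simp add: mismatch_def)

lemma mismatch_hits: "\<exists>lam>0. mismatch lam = real k * pi"
proof -
  \<comment> \<open>The count is \<open>Suc k\<close> because subtracting the target costs up to one
    pi.\<close>
  obtain L where L: "L > 0" "\<And>j. of_int j * pi \<le> angle L a \<Longrightarrow> of_int (j + int (Suc k)) * pi < angle L b"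
    using angle_unbounded[of a "Suc k"] ab by auto
  have "real (Suc k) * pi < angle L b" using L(2)[of 0] angle_init_bounds[of L] by simp
  then have "real k * pi \<le> mismatch L"
    using target_bounds[of L] by (simp add: mismatch_def algebra_simps)
  then have "\<exists>x\<ge>0. x \<le> L \<and> mismatch x = real k * pi"
    using mismatch_0 L(1)
    by (intro IVT' continuous_on_subset[OF mismatch_continuous]) (auto intro: order_trans less_imp_le)
  then obtain x where x: "x \<ge> 0" "mismatch x = real k * pi" by blast
  moreover have "0 \<le> real k * pi" by simp
  ultimately have "x \<noteq> 0" using mismatch_0 by (metis not_less)
  with x show ?thesis by (intro exI[of _ x]) auto
qed

definition eigenvalue_seq :: "nat \<Rightarrow> real" where
  "eigenvalue_seq k = (SOME lam. lam > 0 \<and> mismatch lam = real k * pi)"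

lemma eigenvalue_seq: "eigenvalue_seq k > 0" "mismatch (eigenvalue_seq k) = real k * pi"
  using someI_ex[OF mismatch_hits[of k]] by (auto simp: eigenvalue_seq_def)

lemma eigenvalue_seq_strict_mono: "strict_mono eigenvalue_seq"
proof (rule strict_monoI)
  fix i j :: nat assume "i < j"
  then have "mismatch (eigenvalue_seq i) < mismatch (eigenvalue_seq j)"
    by (simp add: eigenvalue_seq(2))
  then show "eigenvalue_seq i < eigenvalue_seq j"
    using strict_mono_less[OF mismatch_strict_mono] by blast
qed

text \<open>Strict monotonicity lets each non-negative multiple of pi be attained only once, so the
  sequence misses no eigenvalue.\<close>

lemma sin_mismatch_zero_iff: "sin (mismatch lam) = 0 \<longleftrightarrow> lam \<in> range eigenvalue_seq"
proof
  assume "sin (mismatch lam) = 0"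
  then obtain i :: int where i: "mismatch lam = of_int i * pi" by (auto simp: sin_zero_iff_int2)
  have "(-1) * pi < of_int i * pi" using mismatch_gt[of lam] i by simp
  then have "i \<ge> 0" unfolding mult_less_cancel_right by simp
  then have "mismatch lam = mismatch (eigenvalue_seq (nat i))" by (simp add: eigenvalue_seq(2) i)
  then have "lam = eigenvalue_seq (nat i)"
    using strict_mono_eq[OF mismatch_strict_mono] by blast
  then show "lam \<in> range eigenvalue_seq" by simp
next
  assume "lam \<in> range eigenvalue_seq"
  then show "sin (mismatch lam) = 0" by (auto simp: eigenvalue_seq(2))
qed

end

text \<open>The differential equation is imposed only in the open interval and \<open>f'\<close> is
  not assumed continuous. Inside, \<open>V\<close> agrees with the continuous primitive
  \<open>W\<close>; the work is to identify the two at the endpoints, where \<open>V\<close> is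
  given only through the one-sided derivative of \<open>f\<close>.\<close>

lemma quasi_derivative_regular:
  fixes f f' V h :: "real \<Rightarrow> complex" and P :: "real \<Rightarrow> real"
  assumes ab: "a < b" and P: "continuous_on {a..b} P" "\<And>x. x \<in> {a..b} \<Longrightarrow> 0 < P x"
    and h: "continuous_on {a..b} h"
    and f: "\<And>x. x \<in> {a..b} \<Longrightarrow> (f has_vector_derivative f' x) (at x within {a..b})"
    and V_eq: "\<And>x. x \<in> {a..b} \<Longrightarrow> V x = of_real (P x) * f' x"
    and V: "\<And>x. x \<in> {a<..<b} \<Longrightarrow> (V has_vector_derivative h x * f x) (at x)"
    and x: "x \<in> {a..b}"
  shows "(V has_vector_derivative h x * f x) (at x within {a..b})"
proof -
  have f_cont: "continuous_on {a..b} f"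
    using f by (rule continuous_on_vector_derivative)
  have J: "((\<lambda>x. integral {a..x} (\<lambda>t. h t * f t)) has_vector_derivative h x * f x) (at x within {a..b})"
    if "x \<in> {a..b}" for x
    by (rule integral_has_vector_derivative) (use that in \<open>auto intro!: continuous_intros h f_cont\<close>)
  have "((\<lambda>x. V x - integral {a..x} (\<lambda>t. h t * f t)) has_vector_derivative 0) (at x within {a<..<b})"
    if "x \<in> {a<..<b}" for x
  proof -
    have "(V has_vector_derivative h x * f x) (at x within {a<..<b})"
      using V[OF that] by (rule has_vector_derivative_at_within)
    moreover have "((\<lambda>x. integral {a..x} (\<lambda>t. h t * f t)) has_vector_derivative h x * f x) (at x within {a<..<b})"
      using that by (intro has_vector_derivative_within_subset[OF J]) auto
    ultimately show ?thesis using has_vector_derivative_diff by fastforce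
  qed
  from has_vector_derivative_zero_constant[OF convex_real_interval(8) this]
  have "\<exists>C. \<forall>x\<in>{a<..<b}. V x - integral {a..x} (\<lambda>t. h t * f t) = C"
    by blast
  then obtain C where C: "\<And>x. x \<in> {a<..<b} \<Longrightarrow> V x - integral {a..x} (\<lambda>t. h t * f t) = C"
    by blast
  define W where "W x = C + integral {a..x} (\<lambda>t. h t * f t)" for x
  have W: "(W has_vector_derivative h x * f x) (at x within {a..b})" if "x \<in> {a..b}" for x
    unfolding W_def using has_vector_derivative_add[OF has_vector_derivative_const J[OF that]] by simp
  have W_cont: "continuous_on {a..b} W"
    using W by (rule continuous_on_vector_derivative)
  have PW: "continuous_on {a..b} (\<lambda>t. W t / of_real (P t))"
    using P(2) by (intro continuous_intros W_cont P(1)) force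
  have f1: "((\<lambda>x. integral {a..x} (\<lambda>t. W t / of_real (P t))) has_vector_derivative W x / of_real (P x)) (at x within {a..b})"
    if "x \<in> {a..b}" for x
    by (rule integral_has_vector_derivative[OF PW that])
  \<comment> \<open>Inside, \<open>f' = W / P\<close>, so \<open>g\<close> has zero derivative there
    and by continuity is constant up to the endpoints. Uniqueness of its one-sided derivatives then
    gives \<open>V = W\<close> there too.\<close>
  define g where "g x = f x - integral {a..x} (\<lambda>t. W t / of_real (P t))" for x
  have g: "(g has_vector_derivative f' x - W x / of_real (P x)) (at x within {a..b})" if "x \<in> {a..b}" for x
    unfolding g_def using f[OF that] f1[OF that] by (rule has_vector_derivative_diff)
  have g_const: "g x = g a" if "x \<in> {a..b}" for x
  proof (rule has_derivative_zero_unique_strong_interval[of "{a, b}" a b])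
    show "continuous_on {a..b} g"
      using g by (rule continuous_on_vector_derivative)
    fix x assume x: "x \<in> {a..b} - {a, b}"
    then have "f' x - W x / of_real (P x) = 0"
      using V_eq[of x] C[of x] P(2)[of x] by (auto simp: W_def field_simps)
    then show "(g has_derivative (\<lambda>h. 0)) (at x within {a..b})"
      using g[of x] x by (simp add: has_vector_derivative_def)
  qed (use that in auto)
  have "V x = W x" if x: "x \<in> {a..b}" for x
  proof -
    have "(g has_vector_derivative 0) (at x within {a..b})"
      by (rule has_vector_derivative_transform[OF x _ has_vector_derivative_const]) (rule g_const)
    then have "f' x - W x / of_real (P x) = 0"
      using vector_derivative_unique_within_closed_interval[of a b x g "f' x - W x / of_real (P x)" 0]
        g[OF x] ab x by simp
    then show ?thesis using V_eq[OF x] P(2)[OF x] by (simp add: field_simps)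
  qed
  then show ?thesis
    by (intro has_vector_derivative_transform[OF x _ W[OF x]])
qed

section \<open>Complex eigenfunctions: real spectrum, reduction to Pruefer solutions, zeros\<close>

context sturm_liouville
begin

text \<open>\<open>V\<close> plays the role of \<open>P f'\<close>. Carrying it along gives a
  first-order system with continuous coefficients that holds up to the endpoints.\<close>

definition eigen :: "complex \<Rightarrow> (real \<Rightarrow> complex) \<Rightarrow> (real \<Rightarrow> complex) \<Rightarrow> bool" where
  "eigen lam f V \<longleftrightarrow> (\<exists>x\<in>{a..b}. f x \<noteq> 0) \<and>
    (\<forall>x\<in>{a..b}. (f has_vector_derivative of_real (A x) * V x) (at x within {a..b})) \<and>
    (\<forall>x\<in>{a..b}. (V has_vector_derivative (of_real (q x) - lam * of_real (w x)) * f x) (at x within {a..b})) \<and>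
    V a = (of_real \<alpha> - lam * of_real F) * f a \<and> V b = - (of_real \<beta> - lam * of_real G) * f b"

lemma eigenD:
  assumes "eigen lam f V"
  shows "\<exists>x\<in>{a..b}. f x \<noteq> 0"
    "\<And>x. x \<in> {a..b} \<Longrightarrow> (f has_vector_derivative of_real (A x) * V x) (at x within {a..b})"
    "\<And>x. x \<in> {a..b} \<Longrightarrow> (V has_vector_derivative (of_real (q x) - lam * of_real (w x)) * f x) (at x within {a..b})"
    "V a = (of_real \<alpha> - lam * of_real F) * f a" "V b = - (of_real \<beta> - lam * of_real G) * f b"
  using assms by (auto simp: eigen_def)

lemma complex_A_cont: "continuous_on {a..b} (\<lambda>x. complex_of_real (A x))"
  by (intro continuous_on_of_real A_cont)

lemma complex_potential_cont: "continuous_on {a..b} (\<lambda>x. complex_of_real (q x) - lam * of_real (w x))"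
  by (intro continuous_intros q_cont w_cont)

lemma eigen_continuous:
  assumes "eigen lam f V"
  shows "continuous_on {a..b} f" "continuous_on {a..b} V"
  by (rule continuous_on_vector_derivative, erule eigenD(2)[OF assms])
    (rule continuous_on_vector_derivative, erule eigenD(3)[OF assms])

text \<open>If \<open>f\<close> vanished at \<open>a\<close>, the left boundary condition would make
  \<open>V\<close> vanish there too, and uniqueness would annihilate \<open>f\<close>.\<close>

lemma eigen_init_nonzero:
  assumes "eigen lam f V" shows "f a \<noteq> 0"
proof
  assume "f a = 0"
  then have "f x = 0" if "x \<in> {a..b}" for x
    using linear_system_zero[OF complex_A_cont complex_potential_cont eigenD(2,3)[OF assms] _ _ that]
      eigenD(4)[OF assms] by auto
  then show False using eigenD(1)[OF assms] by auto
qed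

lemma eigenvalue_real:
  assumes E: "eigen lam f V" shows "Im lam = 0"
proof -
  \<comment> \<open>The boundary terms and the interior term of \<open>Im (V f\<^sup>*)\<close> have opposite signs.\<close>
  define H where "H x = - Im lam * Im (V x * cnj (f x))" for x
  have H': "(H has_real_derivative (Im lam)\<^sup>2 * (w x * (cmod (f x))\<^sup>2)) (at x within {a..b})" if "x \<in> {a..b}" for x
  proof -
    have "((\<lambda>x. V x * cnj (f x)) has_vector_derivative
        V x * cnj (of_real (A x) * V x) + (of_real (q x) - lam * of_real (w x)) * f x * cnj (f x)) (at x within {a..b})"
      by (intro has_vector_derivative_mult eigenD(3)[OF E that]
          bounded_linear.has_vector_derivative[OF bounded_linear_cnj eigenD(2)[OF E that]])
    from bounded_linear.has_vector_derivative[OF bounded_linear_Im this]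
    have "((\<lambda>x. Im (V x * cnj (f x))) has_real_derivative
        Im (V x * cnj (of_real (A x) * V x) + (of_real (q x) - lam * of_real (w x)) * f x * cnj (f x))) (at x within {a..b})"
      by (simp add: has_real_derivative_iff_has_vector_derivative)
    from DERIV_cmult[OF this, of "- Im lam"] show ?thesis
      unfolding H_def cmod_power2
      by (rule DERIV_cong) (simp add: power2_eq_square algebra_simps)
  qed
  have "H a \<le> H b"
  proof (rule DERIV_nonneg_imp_increasing_open[where f = H])
    show "continuous_on {a..b} H" using H' by (rule DERIV_continuous_on)
    fix x assume x: "a < x" "x < b"
    then have "(H has_real_derivative (Im lam)\<^sup>2 * (w x * (cmod (f x))\<^sup>2)) (at x)"
      using H'[of x] by (simp add: at_within_Icc_at)
    then show "\<exists>y. (H has_real_derivative y) (at x) \<and> 0 \<le> y"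
      using w_nonneg[of x] x by fastforce
  qed (use ab in auto)
  moreover have "H a = (Im lam)\<^sup>2 * (F * (cmod (f a))\<^sup>2)" "H b = - ((Im lam)\<^sup>2 * (G * (cmod (f b))\<^sup>2))"
    unfolding H_def eigenD(4,5)[OF E] cmod_power2 by (simp_all add: power2_eq_square algebra_simps)
  moreover have "0 \<le> (Im lam)\<^sup>2 * (G * (cmod (f b))\<^sup>2)" using G by simp
  \<comment> \<open>From \<open>H a \<le> H b \<le> 0\<close> the non-negative left boundary term is
    forced to vanish, and \<open>f a\<close> is nonzero.\<close>
  ultimately have "(Im lam)\<^sup>2 * (F * (cmod (f a))\<^sup>2) \<le> 0" by simp
  moreover have "0 < F * (cmod (f a))\<^sup>2" using F eigen_init_nonzero[OF E] by simp
  ultimately have "(Im lam)\<^sup>2 \<le> 0" by (meson mult_pos_pos not_le)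
  then show ?thesis by simp
qed

text \<open>The explicit solution of the radial equation
  \<open>r' = (A - B) r sin \<theta> cos \<theta>\<close> with \<open>r = 1\<close> at
  \<open>a\<close>. The exponential form makes it positive, so \<open>u\<close> vanishes only where
  the sine does.\<close>

definition radius :: "real \<Rightarrow> real \<Rightarrow> real" where
  "radius lam x = exp (integral {a..x} (\<lambda>t. (A t - B lam t) * (sin (angle lam t) * cos (angle lam t))))"

definition u :: "real \<Rightarrow> real \<Rightarrow> real" where "u lam x = radius lam x * sin (angle lam x)"
definition v :: "real \<Rightarrow> real \<Rightarrow> real" where "v lam x = radius lam x * cos (angle lam x)"

lemma radius_pos: "0 < radius lam x"
  by (simp add: radius_def)

lemma radius_deriv:
  assumes "x \<in> {a..b}"
  shows "(radius lam has_real_derivative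
    radius lam x * ((A x - B lam x) * (sin (angle lam x) * cos (angle lam x)))) (at x within {a..b})"
proof -
  have "((\<lambda>x. integral {a..x} (\<lambda>t. (A t - B lam t) * (sin (angle lam t) * cos (angle lam t)))) has_real_derivative
      (A x - B lam x) * (sin (angle lam x) * cos (angle lam x))) (at x within {a..b})"
    by (rule integral_has_real_derivative[OF _ assms])
      (intro continuous_on_mult continuous_on_diff A_cont B_cont continuous_on_sin continuous_on_cos
        prufer_on_continuous[OF angle_prufer])
  from DERIV_chain2[OF DERIV_exp this] show ?thesis by (simp add: radius_def[abs_def])
qed

lemma u_deriv:
  assumes "x \<in> {a..b}"
  shows "(u lam has_real_derivative A x * v lam x) (at x within {a..b})"
proof -
  have "(u lam has_real_derivative
      radius lam x * ((A x - B lam x) * (sin (angle lam x) * cos (angle lam x))) * sin (angle lam x)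
      + (cos (angle lam x) * (A x + (B lam x - A x) * (sin (angle lam x))\<^sup>2)) * radius lam x) (at x within {a..b})"
    unfolding u_def
    by (rule DERIV_mult[OF radius_deriv[OF assms] DERIV_chain2[OF DERIV_sin prufer_onD[OF angle_prufer assms]]])
  then show ?thesis
    by (rule DERIV_cong) (simp add: v_def power2_eq_square algebra_simps)
qed

lemma v_deriv:
  assumes "x \<in> {a..b}"
  shows "(v lam has_real_derivative (q x - lam * w x) * u lam x) (at x within {a..b})"
proof -
  have "(v lam has_real_derivative
      radius lam x * ((A x - B lam x) * (sin (angle lam x) * cos (angle lam x))) * cos (angle lam x)
      + (- sin (angle lam x) * (A x + (B lam x - A x) * (sin (angle lam x))\<^sup>2)) * radius lam x) (at x within {a..b})"
    unfolding v_def
    by (rule DERIV_mult[OF radius_deriv[OF assms] DERIV_chain2[OF DERIV_cos prufer_onD[OF angle_prufer assms]]])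
  moreover have "(A x - B lam x) * (sin (angle lam x) * cos (angle lam x)) * cos (angle lam x)
      - sin (angle lam x) * (A x + (B lam x - A x) * (sin (angle lam x))\<^sup>2) = - B lam x * sin (angle lam x)"
    using sin_cos_squared_add[of "angle lam x"] by algebra
  ultimately show ?thesis
    by (elim DERIV_cong) (simp add: u_def, algebra)
qed

lemma u_init: "u lam a \<noteq> 0"
  using sin_gt_zero[OF angle_init_bounds[of lam]] radius_pos[of lam a] by (simp add: u_def)

lemma v_init: "v lam a = (\<alpha> - lam * F) * u lam a"
proof -
  have "angle lam a - (pi / 2 + arctan (- (\<alpha> - lam * F))) = 0"
    unfolding arctan_minus angle_init by simp
  then have "cos (angle lam a) = (\<alpha> - lam * F) * sin (angle lam a)"
    using sin_diff_arctan_zero_iff[of "angle lam a" "- (\<alpha> - lam * F)"] by (simp only: sin_zero minus_minus simp_thms)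
  then show ?thesis by (simp add: u_def v_def)
qed

text \<open>The positive radius cancels, leaving a prescribed cotangent for the final angle, which
  is the cotangent of \<open>target lam\<close>.\<close>

lemma v_final_iff: "v lam b = - (\<beta> - lam * G) * u lam b \<longleftrightarrow> lam \<in> range eigenvalue_seq"
proof -
  have "v lam b = - (\<beta> - lam * G) * u lam b \<longleftrightarrow>
      radius lam b * cos (angle lam b) = radius lam b * (- (\<beta> - lam * G) * sin (angle lam b))"
    by (simp add: u_def v_def mult_ac)
  also have "\<dots> \<longleftrightarrow> cos (angle lam b) = - (\<beta> - lam * G) * sin (angle lam b)"
    unfolding mult_cancel_left using radius_pos[of lam b] by simp
  also have "\<dots> \<longleftrightarrow> sin (mismatch lam) = 0"
    unfolding mismatch_def target_def sin_diff_arctan_zero_iff ..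
  finally show ?thesis by (simp add: sin_mismatch_zero_iff)
qed

text \<open>Scaling \<open>u\<close> to match \<open>f\<close> at \<open>a\<close> also matches
  \<open>v\<close> with \<open>V\<close>, as both pairs satisfy the left boundary condition. The
  difference solves the linear system with zero data. Thus eigenvalues are geometrically
  simple.\<close>

lemma eigen_proportional:
  assumes E: "eigen (of_real lam) f V"
  obtains c where "c \<noteq> 0" "\<And>x. x \<in> {a..b} \<Longrightarrow> f x = c * of_real (u lam x) \<and> V x = c * of_real (v lam x)"
proof
  define c where "c = f a / of_real (u lam a)"
  show "c \<noteq> 0" using eigen_init_nonzero[OF E] u_init[of lam] by (simp add: c_def)
  define f0 where "f0 x = f x - c * of_real (u lam x)" for x
  define V0 where "V0 x = V x - c * of_real (v lam x)" for x
  have init: "f0 a = 0" using u_init[of lam] by (simp add: f0_def c_def)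
  then have "V0 a = 0"
    using eigenD(4)[OF E] by (simp add: V0_def f0_def v_init)
  have f0: "(f0 has_vector_derivative of_real (A x) * V0 x) (at x within {a..b})" if x: "x \<in> {a..b}" for x
  proof -
    have "(f0 has_vector_derivative of_real (A x) * V x - c * of_real (A x * v lam x)) (at x within {a..b})"
      unfolding f0_def
      by (intro has_vector_derivative_diff eigenD(2)[OF E x] has_vector_derivative_mult_right
          has_vector_derivative_of_real u_deriv x)
    then show ?thesis by (simp add: V0_def algebra_simps)
  qed
  have V0: "(V0 has_vector_derivative (of_real (q x) - of_real lam * of_real (w x)) * f0 x) (at x within {a..b})"
    if x: "x \<in> {a..b}" for x
  proof -
    have "(V0 has_vector_derivative (of_real (q x) - of_real lam * of_real (w x)) * f x
        - c * of_real ((q x - lam * w x) * u lam x)) (at x within {a..b})"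
      unfolding V0_def
      by (intro has_vector_derivative_diff eigenD(3)[OF E x] has_vector_derivative_mult_right
          has_vector_derivative_of_real v_deriv x)
    then show ?thesis by (simp add: f0_def algebra_simps)
  qed
  show "f x = c * of_real (u lam x) \<and> V x = c * of_real (v lam x)" if "x \<in> {a..b}" for x
    using linear_system_zero[OF complex_A_cont complex_potential_cont f0 V0 init \<open>V0 a = 0\<close> that]
    by (simp add: f0_def V0_def)
qed

lemma eigenvalues: "(\<exists>f V. eigen lam f V) \<longleftrightarrow> lam \<in> range (\<lambda>i. complex_of_real (eigenvalue_seq i))"
proof
  assume "\<exists>f V. eigen lam f V"
  then obtain f V where E: "eigen lam f V" by blast
  define l where "l = Re lam"
  have lam: "lam = of_real l" using eigenvalue_real[OF E] by (simp add: l_def complex_eq_iff)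
  obtain c where c: "c \<noteq> 0" "f b = c * of_real (u l b)" "V b = c * of_real (v l b)"
    using eigen_proportional[OF E[unfolded lam]] ab by (metis atLeastAtMost_iff less_imp_le order_refl)
  have "c * of_real (v l b) = c * of_real (- (\<beta> - l * G) * u l b)"
    using eigenD(5)[OF E] by (simp add: lam c algebra_simps)
  then have "complex_of_real (v l b) = of_real (- (\<beta> - l * G) * u l b)"
    using c(1) unfolding mult_cancel_left by blast
  then have "l \<in> range eigenvalue_seq" unfolding of_real_eq_iff v_final_iff .
  then show "lam \<in> range (\<lambda>i. complex_of_real (eigenvalue_seq i))" using lam by auto
next
  assume "lam \<in> range (\<lambda>i. complex_of_real (eigenvalue_seq i))"
  then obtain i where i: "lam = of_real (eigenvalue_seq i)" by auto
  define l where "l = eigenvalue_seq i"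
  have "eigen lam (\<lambda>x. of_real (u l x)) (\<lambda>x. of_real (v l x))"
    unfolding eigen_def
  proof (intro conjI ballI)
    show "\<exists>x\<in>{a..b}. complex_of_real (u l x) \<noteq> 0" using u_init[of l] ab by (intro bexI[of _ a]) auto
    show "((\<lambda>x. complex_of_real (u l x)) has_vector_derivative of_real (A x) * of_real (v l x)) (at x within {a..b})"
      if "x \<in> {a..b}" for x
      using has_vector_derivative_of_real[OF u_deriv[OF that]] unfolding of_real_mult .
    show "((\<lambda>x. complex_of_real (v l x)) has_vector_derivative
        (of_real (q x) - lam * of_real (w x)) * of_real (u l x)) (at x within {a..b})"
      if "x \<in> {a..b}" for x
      using has_vector_derivative_of_real[OF v_deriv[OF that, of l]]
      unfolding of_real_mult of_real_diff i l_def .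
    show "complex_of_real (v l a) = (of_real \<alpha> - lam * of_real F) * of_real (u l a)"
      by (simp add: i l_def v_init)
    have "v l b = - (\<beta> - l * G) * u l b" unfolding v_final_iff by (simp add: l_def)
    then show "complex_of_real (v l b) = - (of_real \<beta> - lam * of_real G) * of_real (u l b)"
      by (simp add: i l_def)
  qed
  then show "\<exists>f V. eigen lam f V" by blast
qed

text \<open>The angle starts in (0, pi) and passes each multiple of pi only once, because crossings
  go upwards. The interior zeros of the sine thus correspond to the levels pi, 2 pi, ..., k
  pi.\<close>

lemma angle_zero_count:
  assumes "of_nat k * pi < angle lam b" "angle lam b < of_nat (Suc k) * pi"
  defines "Z \<equiv> {x\<in>{a<..<b}. sin (angle lam x) = 0}"
  shows "finite Z \<and> card Z = k"
proof -
  have img: "angle lam ` Z = (\<lambda>j. real j * pi) ` {1..k}"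
  proof (intro equalityI subsetI)
    fix y assume "y \<in> angle lam ` Z"
    then obtain x where x: "a < x" "x < b" "sin (angle lam x) = 0" "y = angle lam x" by (auto simp: Z_def)
    then obtain i :: int where i: "angle lam x = of_int i * pi" by (auto simp: sin_zero_iff_int2)
    have "0 * pi < of_int i * pi" using angle_pos[of x lam] x i by simp
    then have "0 < i" by (simp add: zero_less_mult_iff)
    moreover have "of_int i * pi < angle lam b" using angle_above[of i lam x b] x i by simp
    then have "of_int i * pi < of_nat (Suc k) * pi" using assms(2) by linarith
    then have "real_of_int i < of_nat (Suc k)" by (simp add: mult_less_cancel_right)
    then have "i < int (Suc k)" by linarith
    ultimately show "y \<in> (\<lambda>j. real j * pi) ` {1..k}"
      using x(4) i by (intro image_eqI[of _ _ "nat i"]) auto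
  next
    fix y assume "y \<in> (\<lambda>j. real j * pi) ` {1..k}"
    then obtain j where j: "1 \<le> j" "j \<le> k" "y = real j * pi" by auto
    have "1 * pi \<le> real j * pi" "real j * pi \<le> real k * pi"
      using j by (intro mult_right_mono; simp)+
    then have lo: "angle lam a < y" and hi: "y < angle lam b"
      using angle_init_bounds(2)[of lam] assms(1) unfolding j(3) by linarith+
    have "\<exists>x\<ge>a. x \<le> b \<and> angle lam x = y"
      using lo hi ab by (intro IVT' prufer_on_continuous[OF angle_prufer]) auto
    then obtain x where x: "a \<le> x" "x \<le> b" "angle lam x = y" by blast
    then have "x \<noteq> a" "x \<noteq> b" using lo hi by auto
    then have "x \<in> Z" using x j by (auto simp: Z_def)
    then show "y \<in> angle lam ` Z" using x by auto
  qed
  have neq: "angle lam x \<noteq> angle lam y" if "x \<in> Z" "y \<in> Z" "x < y" for x y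
  proof -
    obtain i :: int where "angle lam x = of_int i * pi" using \<open>x \<in> Z\<close> by (auto simp: Z_def sin_zero_iff_int2)
    then show ?thesis using angle_above[of i lam x y] that by (auto simp: Z_def)
  qed
  have inj: "inj_on (angle lam) Z"
  proof (rule inj_onI)
    fix x y assume "x \<in> Z" "y \<in> Z" "angle lam x = angle lam y"
    then show "x = y" using neq[of x y] neq[of y x] by (cases x y rule: linorder_cases) auto
  qed
  have "finite Z" using finite_imageD[OF _ inj] by (simp add: img)
  moreover have "card Z = card ((\<lambda>j. real j * pi) ` {1..k})" using card_image[OF inj] by (simp add: img)
  moreover have "inj_on (\<lambda>j. real j * pi) {1..k}" by (auto intro: inj_onI)
  ultimately show ?thesis by (simp add: card_image)
qed

lemma eigen_zero_count:
  assumes E: "eigen (of_real (eigenvalue_seq k)) f V"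
  shows "finite {x\<in>{a<..<b}. f x = 0} \<and> card {x\<in>{a<..<b}. f x = 0} = k"
proof -
  let ?l = "eigenvalue_seq k"
  obtain c where c: "c \<noteq> 0" "\<And>x. x \<in> {a..b} \<Longrightarrow> f x = c * of_real (u ?l x)"
    using eigen_proportional[OF E] by metis
  have "f x = 0 \<longleftrightarrow> sin (angle ?l x) = 0" if "x \<in> {a<..<b}" for x
    using c(1) c(2)[of x] that radius_pos[of ?l x] by (simp add: u_def)
  then have "{x\<in>{a<..<b}. f x = 0} = {x\<in>{a<..<b}. sin (angle ?l x) = 0}" by blast
  moreover have "angle ?l b = real k * pi + target ?l"
    using eigenvalue_seq(2)[of k] by (simp add: mismatch_def)
  then have "of_nat k * pi < angle ?l b" "angle ?l b < of_nat (Suc k) * pi"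
    using target_bounds[of ?l] by (auto simp: algebra_simps)
  ultimately show ?thesis using angle_zero_count by simp
qed

end

section \<open>The Hele-Shaw eigenvalue problem\<close>

theorem theorem1:
  fixes Q n mui muo R10 R20 tau T1 T2 :: real
    and mu mu' :: "real \<Rightarrow> real"
  assumes "Q > 0" "n > 0" "mui > 0" "muo > 0" "0 < R10" "R10 < R20" "tau \<ge> 0"
    and "\<forall>x\<in>{zeta1 R10 R20..1}. (mu has_real_derivative mu' x) (at x within {zeta1 R10 R20..1})"
    and "continuous_on {zeta1 R10 R20..1} mu'"
    and "\<forall>x\<in>{zeta1 R10 R20..1}. mu x > 0"
    and "strict_mono_on {zeta1 R10 R20..1} mu"
    and "F1 Q n mui R10 R20 tau T1 mu > 0"
    and "F2 Q n muo R20 tau T2 mu > 0"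
  shows "\<exists>lams :: nat \<Rightarrow> real.
           strict_mono lams \<and> 0 < lams 0 \<and>
           {lam. \<exists>f. eigenpair Q n mui muo R10 R20 tau T1 T2 mu mu' lam f}
             = range (\<lambda>i. complex_of_real (lams i)) \<and>
           (\<forall>i f. eigenpair Q n mui muo R10 R20 tau T1 T2 mu mu' (complex_of_real (lams i)) f \<longrightarrow>
              finite {x\<in>{zeta1 R10 R20<..<1}. f x = 0} \<and>
              card {x\<in>{zeta1 R10 R20<..<1}. f x = 0} = i) \<and>
           (\<forall>lam f. eigenpair Q n mui muo R10 R20 tau T1 T2 mu mu' lam f \<longrightarrow>
              continuous_on {zeta1 R10 R20..1} f \<and>
              (\<exists>f'. (\<forall>x\<in>{zeta1 R10 R20..1}.
                        (f has_vector_derivative f' x) (at x within {zeta1 R10 R20..1})) \<and>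
                     continuous_on {zeta1 R10 R20..1} f'))"
proof -
  define z where "z = zeta1 R10 R20"
  define p where "p x = x * R20\<^sup>2 + R0sq Q tau" for x
  define f1 where "f1 = F1 Q n mui R10 R20 tau T1 mu"
  define f2 where "f2 = F2 Q n muo R20 tau T2 mu"
  define P where "P x = p x * mu x" for x
  define q where "q x = n\<^sup>2 * R20 ^ 4 / (4 * p x) * mu x" for x
  define w where "w x = Q * n\<^sup>2 * R20\<^sup>2 / (4 * pi * p x) * mu' x" for x
  \<comment> \<open>Multiplying the boundary conditions by this factor turns the coefficients of
    \<open>f'\<close> into \<open>P z\<close> and \<open>P 1\<close>, because \<open>p\<close> takes
    the values \<open>R1sq\<close> and \<open>R2sq\<close> at the endpoints.\<close>
  define \<kappa> where "\<kappa> = n * R20\<^sup>2 / 2"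
  have R20: "R20 > 0" using assms by simp
  have z: "0 < z" "z < 1"
    using assms R20 by (auto simp: z_def zeta1_def power_strict_mono)
  have \<kappa>: "\<kappa> > 0" using assms R20 by (simp add: \<kappa>_def)
  have p_pos: "0 < p x" if "x \<in> {z..1}" for x
    unfolding p_def R0sq_def using that z R20 assms by (intro add_pos_nonneg mult_pos_pos) auto
  have p_cont: "continuous_on {z..1} p" unfolding p_def by (intro continuous_intros)
  have p_neq: "\<forall>x\<in>{z..1}. p x \<noteq> 0" using p_pos by force
  have p_ends: "p z = R1sq Q R10 tau" "p 1 = R2sq Q R20 tau"
    using R20 by (auto simp: p_def z_def zeta1_def R0sq_def R1sq_def R2sq_def)
  have mu_deriv: "(mu has_real_derivative mu' x) (at x within {z..1})" if "x \<in> {z..1}" for x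
    using assms(8) that by (simp add: z_def)
  have mu_cont: "continuous_on {z..1} mu" using mu_deriv by (rule DERIV_continuous_on)
  have mu_pos: "0 < mu x" if "x \<in> {z..1}" for x using assms(10) that by (simp add: z_def)
  have mu_less: "mu x < mu y" if "x \<in> {z..1}" "y \<in> {z..1}" "x < y" for x y
    using strict_mono_onD[OF assms(11)] that by (simp add: z_def)
  \<comment> \<open>A negative slope would contradict strict increase on nearby points: those to the
    right if \<open>x < 1\<close>, those to the left at \<open>x = 1\<close>.\<close>
  have mu'_nonneg: "0 \<le> mu' x" if x: "x \<in> {z..1}" for x
  proof (rule ccontr)
    assume "\<not> 0 \<le> mu' x"
    then have neg: "mu' x < 0" by simp
    show False
    proof (cases "x < 1")
      case True
      obtain d where d: "d > 0" "\<And>h. 0 < h \<Longrightarrow> x + h \<in> {z..1} \<Longrightarrow> h < d \<Longrightarrow> mu (x + h) < mu x"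
        using has_real_derivative_neg_dec_right[OF mu_deriv[OF x] neg] by blast
      define h where "h = min (d / 2) (1 - x)"
      have "0 < h" "h < d" "x + h \<in> {z..1}" using d(1) True x by (auto simp: h_def min_def)
      then show False using d(2)[of h] mu_less[of x "x + h"] x by auto
    next
      case False
      then have "x = 1" using x by simp
      obtain d where d: "d > 0" "\<And>h. 0 < h \<Longrightarrow> x - h \<in> {z..1} \<Longrightarrow> h < d \<Longrightarrow> mu x < mu (x - h)"
        using has_real_derivative_neg_dec_left[OF mu_deriv[OF x] neg] by blast
      define h where "h = min (d / 2) (x - z)"
      have "0 < h" "h < d" "x - h \<in> {z..1}" using d(1) \<open>x = 1\<close> z by (auto simp: h_def min_def)
      then show False using d(2)[of h] mu_less[of "x - h" x] x by auto
    qed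
  qed
  \<comment> \<open>Strict increase gives a positive mean slope over \<open>{c..d}\<close>, which
    the mean value theorem realises inside. Hence the weight vanishes on no interval.\<close>
  have mu'_pos_dense: "\<exists>x\<in>{c<..<d}. 0 < mu' x" if cd: "z \<le> c" "c < d" "d \<le> 1" for c d
  proof -
    have "(mu has_derivative (\<lambda>h. h * mu' x)) (at x)" if "c < x" "x < d" for x
      using mu_deriv[of x] cd that
      by (simp add: at_within_Icc_at has_field_derivative_def mult_commute_abs)
    then obtain \<xi> where \<xi>: "c < \<xi>" "\<xi> < d" "mu d - mu c = (d - c) * mu' \<xi>"
      using mvt[OF cd(2) continuous_on_subset[OF mu_cont], of "\<lambda>x h. h * mu' x"] cd by auto
    then have "0 < (d - c) * mu' \<xi>" using mu_less[of c d] cd by simp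
    then show ?thesis using \<xi> cd by (auto simp: zero_less_mult_iff)
  qed
  interpret SL: sturm_liouville z 1 "\<kappa> * mui" "\<kappa> * muo" "\<kappa> * f1" "\<kappa> * f2" P q w
  proof
    show "continuous_on {z..1} P" unfolding P_def by (intro continuous_intros p_cont mu_cont)
    show "continuous_on {z..1} q" unfolding q_def
      by (intro continuous_intros p_cont mu_cont) (use p_neq in auto)
    show "continuous_on {z..1} w" unfolding w_def
      by (intro continuous_intros p_cont assms(9)[folded z_def]) (use p_neq in auto)
    show "0 < P x" "0 < q x" "0 \<le> w x" if "x \<in> {z..1}" for x
      using p_pos[OF that] mu_pos[OF that] mu'_nonneg[OF that] assms R20
      by (auto simp: P_def q_def w_def)
    show "\<exists>x\<in>{c<..<d}. 0 < w x" if cd: "z \<le> c" "c < d" "d \<le> 1" for c d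
    proof -
      obtain x where x: "x \<in> {c<..<d}" "0 < mu' x" using mu'_pos_dense[OF cd] by blast
      have "0 < w x" using p_pos[of x] x cd assms R20 by (auto simp: w_def)
      then show ?thesis using x by blast
    qed
  qed (use z \<kappa> assms in \<open>auto simp: f1_def f2_def\<close>)
  have bc1: "(complex_of_real mui - lam * of_real f1) * y - of_real (2 * R1sq Q R10 tau / (n * R20\<^sup>2) * mu z) * y' = 0
      \<longleftrightarrow> of_real (P z) * y' = (of_real (\<kappa> * mui) - lam * of_real (\<kappa> * f1)) * y" for lam y y'
  proof -
    have e: "2 * R1sq Q R10 tau / (n * R20\<^sup>2) * mu z = P z / \<kappa>"
      by (simp add: P_def p_ends \<kappa>_def)
    show ?thesis unfolding e of_real_divide of_real_mult using \<kappa> by (auto simp: field_simps)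
  qed
  have bc2: "(complex_of_real muo - lam * of_real f2) * y + of_real (2 * R2sq Q R20 tau / (n * R20\<^sup>2) * mu 1) * y' = 0
      \<longleftrightarrow> of_real (P 1) * y' = - (of_real (\<kappa> * muo) - lam * of_real (\<kappa> * f2)) * y" for lam y y'
  proof -
    have e: "2 * R2sq Q R20 tau / (n * R20\<^sup>2) * mu 1 = P 1 / \<kappa>"
      by (simp add: P_def p_ends \<kappa>_def)
    have "(complex_of_real muo - lam * of_real f2) * y + of_real (P 1 / \<kappa>) * y' = 0
      \<longleftrightarrow> of_real \<kappa> * ((complex_of_real muo - lam * of_real f2) * y) + of_real (P 1) * y' = 0"
      unfolding of_real_divide using \<kappa> by (simp add: field_simps)
    then show ?thesis unfolding e by (simp add: eq_neg_iff_add_eq_0 algebra_simps)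
  qed
  have eigenpair_unfold: "eigenpair Q n mui muo R10 R20 tau T1 T2 mu mu' lam f \<longleftrightarrow>
    (\<exists>x\<in>{z..1}. f x \<noteq> 0) \<and>
    (\<exists>f' g. (\<forall>x\<in>{z..1}. (f has_vector_derivative f' x) (at x within {z..1})) \<and>
      (\<forall>x\<in>{z<..<1}. ((\<lambda>t. complex_of_real (P t) * f' t) has_vector_derivative g x) (at x) \<and>
        g x - (complex_of_real (q x) - complex_of_real (w x) * lam) * f x = 0) \<and>
      of_real (P z) * f' z = (of_real (\<kappa> * mui) - lam * of_real (\<kappa> * f1)) * f z \<and>
      of_real (P 1) * f' 1 = - (of_real (\<kappa> * muo) - lam * of_real (\<kappa> * f2)) * f 1)" for lam f
    unfolding eigenpair_def Let_def z_def[symmetric] p_def[symmetric] f1_def[symmetric] f2_def[symmetric]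
      bc1 bc2 P_def[symmetric] q_def[symmetric] w_def[symmetric] ..
  have eigenpair_iff: "eigenpair Q n mui muo R10 R20 tau T1 T2 mu mu' lam f \<longleftrightarrow> (\<exists>V. SL.eigen lam f V)" for lam f
  proof
    assume "eigenpair Q n mui muo R10 R20 tau T1 T2 mu mu' lam f"
    then obtain f' g where nz: "\<exists>x\<in>{z..1}. f x \<noteq> 0"
      and f': "\<And>x. x \<in> {z..1} \<Longrightarrow> (f has_vector_derivative f' x) (at x within {z..1})"
      and g: "\<And>x. x \<in> {z<..<1} \<Longrightarrow> ((\<lambda>t. complex_of_real (P t) * f' t) has_vector_derivative g x) (at x)"
        "\<And>x. x \<in> {z<..<1} \<Longrightarrow> g x - (complex_of_real (q x) - complex_of_real (w x) * lam) * f x = 0"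
      and bc: "of_real (P z) * f' z = (of_real (\<kappa> * mui) - lam * of_real (\<kappa> * f1)) * f z"
        "of_real (P 1) * f' 1 = - (of_real (\<kappa> * muo) - lam * of_real (\<kappa> * f2)) * f 1"
      unfolding eigenpair_unfold by blast
    define V where "V t = complex_of_real (P t) * f' t" for t
    have "(V has_vector_derivative (of_real (q x) - lam * of_real (w x)) * f x) (at x within {z..1})"
      if "x \<in> {z..1}" for x
    proof (rule quasi_derivative_regular[OF z(2) SL.P_cont SL.P_pos SL.complex_potential_cont f' _ _ that])
      show "(V has_vector_derivative (of_real (q x) - lam * of_real (w x)) * f x) (at x)"
        if "x \<in> {z<..<1}" for x
        using g(1)[OF that] g(2)[OF that] by (simp add: V_def[abs_def] mult.commute)
    qed (auto simp: V_def)
    moreover have "(f has_vector_derivative of_real (1 / P x) * V x) (at x within {z..1})"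
      if "x \<in> {z..1}" for x
      using f'[OF that] SL.P_pos[OF that] by (simp add: V_def)
    ultimately have "SL.eigen lam f V" unfolding SL.eigen_def using nz bc by (auto simp: V_def)
    then show "\<exists>V. SL.eigen lam f V" by blast
  next
    assume "\<exists>V. SL.eigen lam f V"
    then obtain V where V: "SL.eigen lam f V" by blast
    define f' where "f' x = complex_of_real (1 / P x) * V x" for x
    have Pf': "of_real (P x) * f' x = V x" if "x \<in> {z..1}" for x
      using SL.P_pos[OF that] by (simp add: f'_def)
    have "((\<lambda>t. complex_of_real (P t) * f' t) has_vector_derivative (of_real (q x) - of_real (w x) * lam) * f x) (at x)"
      if x: "x \<in> {z<..<1}" for x
    \<comment> \<open>\<open>P f' = V\<close> is available only on the closed interval, so the
      derivative of \<open>V\<close> is transferred on the open one.\<close>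
    proof (rule has_vector_derivative_transform_within_open[of _ _ _ "{z<..<1}"])
      show "(V has_vector_derivative (of_real (q x) - of_real (w x) * lam) * f x) (at x)"
        using SL.eigenD(3)[OF V, of x] x by (simp add: at_within_Icc_at mult.commute)
    qed (use x Pf' in auto)
    then show "eigenpair Q n mui muo R10 R20 tau T1 T2 mu mu' lam f"
      unfolding eigenpair_unfold
      using SL.eigenD[OF V] Pf'[of z] Pf'[of 1] z
      by (intro conjI exI[of _ f'] exI[of _ "\<lambda>x. (of_real (q x) - of_real (w x) * lam) * f x"])
        (auto simp: f'_def)
  qed
  show ?thesis
    unfolding z_def[symmetric] eigenpair_iff
  proof (intro exI[of _ SL.eigenvalue_seq] conjI allI impI)
    show "strict_mono SL.eigenvalue_seq" by (rule SL.eigenvalue_seq_strict_mono)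
    show "0 < SL.eigenvalue_seq 0" by (rule SL.eigenvalue_seq)
    show "{lam. \<exists>f V. SL.eigen lam f V} = range (\<lambda>i. complex_of_real (SL.eigenvalue_seq i))"
      using SL.eigenvalues by blast
  next
    fix i f assume "\<exists>V. SL.eigen (complex_of_real (SL.eigenvalue_seq i)) f V"
    then show "finite {x\<in>{z<..<1}. f x = 0}" "card {x\<in>{z<..<1}. f x = 0} = i"
      using SL.eigen_zero_count by blast+
  next
    fix lam f assume "\<exists>V. SL.eigen lam f V"
    then obtain V where V: "SL.eigen lam f V" by blast
    show "continuous_on {z..1} f" by (rule SL.eigen_continuous[OF V])
    have "continuous_on {z..1} (\<lambda>x. complex_of_real (1 / P x) * V x)"
      by (intro continuous_on_mult SL.complex_A_cont SL.eigen_continuous[OF V])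
    then show "\<exists>f'. (\<forall>x\<in>{z..1}. (f has_vector_derivative f' x) (at x within {z..1})) \<and> continuous_on {z..1} f'"
      by (intro exI[of _ "\<lambda>x. complex_of_real (1 / P x) * V x"] conjI ballI SL.eigenD(2)[OF V])
  qed
qed

end
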